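(* Let $q=2$, $m\geq 6$, $n=2^m-1$, and $2\le\delta\le n$. Then the dual code $\widetilde{\mathcal{C}}_{(2,n,\delta)}^{\perp}$ is a narrow-sense BCH code if and only if $$\delta=2,\ 3,\quad\text{or}\quad 2^{m-1}-2^{\lfloor \frac{m-1}{2}\rfloor}\leq \delta\leq 2^{m-1}-1.$$
   Context: Let $\alpha$ be a generator of $\mathbb{F}_{2^m}^*$; it is a primitive $n$-th root of unity for $n=2^m-1$. For an integer $j$ let $m_j(x)$ be the minimal polynomial of $\alpha^j$ over $\mathbb{F}_2$. For $2\le\delta\le n$ put $g_\delta(x)=\mathrm{lcm}(m_1(x),\dots,m_{\delta-1}(x))$. The narrow-sense BCH code with designed distance $\delta$ is the cyclic code of length $n$ over $\mathbb{F}_2$ (an ideal of $\mathbb{F}_2[x]/\langle x^n-1\rangle$) generated by $g_\delta(x)$, and $\widetilde{\mathcal{C}}_{(2,n,\delta)}$ is the cyclic code of length $n$ generated by $(x-1)g_\delta(x)$. The dual is taken with respect to the standard inner product, and "is a narrow-sense BCH code" means: equals the code generated by $g_{\delta'}(x)$, with respect to the same $\alpha$, for some $2\le\delta'\le n$. *)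

theory Defs
  imports
    "HOL-Library.Z2"
    "HOL-Library.Cardinality"
    "HOL-Computational_Algebra.Computational_Algebra"
    "HOL-Computational_Algebra.Field_as_Ring"
    "Jordan_Normal_Form.Matrix"
begin

text \<open>The two-element field is the type \<open>bit\<close>. It is made an instance of \<open>field_gcd\<close> so that
  \<open>Lcm\<close> is available on \<open>bit poly\<close>.\<close>

instantiation bit ::
  "{unique_euclidean_ring, normalization_euclidean_semiring, normalization_semidom_multiplicative}"
begin

definition [simp]: "normalize_bit = (normalize_field :: bit \<Rightarrow> _)"
definition [simp]: "unit_factor_bit = (unit_factor_field :: bit \<Rightarrow> _)"
definition [simp]: "euclidean_size_bit = (euclidean_size_field :: bit \<Rightarrow> _)"
definition [simp]: "division_segment (x :: bit) = 1"

instance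
  by standard (auto simp: dvd_field_iff)

end

instantiation bit :: euclidean_ring_gcd
begin

definition gcd_bit :: "bit \<Rightarrow> bit \<Rightarrow> bit" where
  "gcd_bit = Euclidean_Algorithm.gcd"
definition lcm_bit :: "bit \<Rightarrow> bit \<Rightarrow> bit" where
  "lcm_bit = Euclidean_Algorithm.lcm"
definition Gcd_bit :: "bit set \<Rightarrow> bit" where
  "Gcd_bit = Euclidean_Algorithm.Gcd"
definition Lcm_bit :: "bit set \<Rightarrow> bit" where
  "Lcm_bit = Euclidean_Algorithm.Lcm"

instance
  by standard (simp_all add: gcd_bit_def lcm_bit_def Gcd_bit_def Lcm_bit_def)

end

instance bit :: field_gcd ..

definition generates_units :: "'a::finite_field \<Rightarrow> bool" where
  "generates_units \<alpha> \<longleftrightarrow> range (\<lambda>k::nat. \<alpha> ^ k) = UNIV - {0}"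

text \<open>Only meaningful for \<open>'a\<close> of characteristic 2, where \<open>of_bit\<close> is the embedding of the
  prime field.\<close>

definition eval_bit_poly :: "bit poly \<Rightarrow> 'a::finite_field \<Rightarrow> 'a" where
  "eval_bit_poly p x = poly (map_poly of_bit p) x"

definition min_poly :: "'a::finite_field \<Rightarrow> bit poly" where
  "min_poly \<beta> = (THE p. lead_coeff p = 1 \<and> eval_bit_poly p \<beta> = 0 \<and>
     (\<forall>q. q \<noteq> 0 \<and> eval_bit_poly q \<beta> = 0 \<longrightarrow> degree p \<le> degree q))"

definition code_poly :: "bit vec \<Rightarrow> bit poly" where
  "code_poly c = (\<Sum>i<dim_vec c. monom (c $ i) i)"

text \<open>Residue classes modulo \<open>x\<^sup>n - 1\<close> are represented by their remainders, so the
  right-hand side ranges over the principal ideal generated by the class of \<open>g\<close>.\<close>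

definition cyclic_code :: "nat \<Rightarrow> bit poly \<Rightarrow> bit vec set" where
  "cyclic_code n g =
     {c \<in> carrier_vec n. \<exists>u. code_poly c = (u * g) mod (monom 1 n - 1)}"

definition bch_gen :: "'a::finite_field \<Rightarrow> nat \<Rightarrow> bit poly" where
  "bch_gen \<alpha> \<delta> = Lcm ((\<lambda>j. min_poly (\<alpha> ^ j)) ` {1..\<delta> - 1})"

definition bch_code :: "'a::finite_field \<Rightarrow> nat \<Rightarrow> nat \<Rightarrow> bit vec set" where
  "bch_code \<alpha> n \<delta> = cyclic_code n (bch_gen \<alpha> \<delta>)"

definition bch_code_tilde :: "'a::finite_field \<Rightarrow> nat \<Rightarrow> nat \<Rightarrow> bit vec set" where
  "bch_code_tilde \<alpha> n \<delta> = cyclic_code n ((monom 1 1 - 1) * bch_gen \<alpha> \<delta>)"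

definition dual_code :: "nat \<Rightarrow> bit vec set \<Rightarrow> bit vec set" where
  "dual_code n C = {v \<in> carrier_vec n. \<forall>c\<in>C. v \<bullet> c = 0}"

definition is_narrow_sense_bch :: "'a::finite_field \<Rightarrow> nat \<Rightarrow> bit vec set \<Rightarrow> bool" where
  "is_narrow_sense_bch \<alpha> n C \<longleftrightarrow> (\<exists>\<delta>'. 2 \<le> \<delta>' \<and> \<delta>' \<le> n \<and> C = bch_code \<alpha> n \<delta>')"

end

theory Submission
  imports Defs
begin

text \<open>A cyclic code is determined by its zeros, a set of nonzero field elements closed under
  squaring, and the zeros of the dual are the inverses of the nonzeros: one inclusion is Parseval's
  identity, the other pairs a dual word with the code words
  \<open>l \<mapsto> Tr (\<theta> x\<^sup>l)\<close>. On exponents, squaring is doubling modulo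
  \<open>n = 2\<^sup>m - 1\<close>, that is, rotation of \<open>m\<close> binary digits, and inversion is
  \<open>i \<mapsto> n - i\<close>. Hence the dual is a narrow-sense BCH code iff, for some \<open>D\<close>, the
  largest rotation of \<open>i\<close> is at most \<open>M = n - \<delta>\<close> exactly when its smallest rotation is
  at most \<open>D\<close>.

  If \<open>2\<^bsup>m-1\<^esup> \<le> M < 2\<^bsup>m-1\<^esup> + 2\<^bsup>k\<^esup>\<close> with \<open>k = (m - 1) div 2\<close>, then only the
  powers of two have all rotations at most \<open>M\<close>; if \<open>\<delta> \<le> 3\<close>, only the orbit of \<open>n - 1\<close> is
  excluded. For every other \<open>M\<close> no \<open>D\<close> exists: if \<open>M\<close> is below \<open>2\<^bsup>m-1\<^esup>\<close> then \<open>1\<close> is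
  excluded, and otherwise there are \<open>x\<close> and \<open>y\<close> such that all rotations of \<open>y\<close>
  lie between \<open>x\<close> and \<open>M\<close> although some rotation of \<open>x\<close> exceeds \<open>M\<close>.\<close>

subsection \<open>Orbits of doubling modulo \<open>2\<^sup>m - 1\<close>\<close>

lemma orbit_invariant:
  fixes i n t :: nat
  assumes "i < n" "P i" and step: "\<And>z. z < n \<Longrightarrow> P z \<Longrightarrow> P (2 * z mod n)"
  shows "P (i * 2 ^ t mod n)"
proof (induction t)
  case 0
  then show ?case using assms by simp
next
  case (Suc t)
  have "i * 2 ^ Suc t mod n = 2 * (i * 2 ^ t mod n) mod n"
    by (simp add: mod_mult_right_eq mult_ac)
  then show ?case using Suc step[of "i * 2 ^ t mod n"] \<open>i < n\<close> by simp
qed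

lemma double_mod: "z < n \<Longrightarrow> 2 * z mod n = (if 2 * z < n then 2 * z else 2 * z - n)" for z n :: nat
  by (auto simp: le_mod_geq not_less)

lemma orbit_pos:
  fixes i n t :: nat
  assumes "odd n" "0 < i" "i < n"
  shows "0 < i * 2 ^ t mod n"
proof (rule orbit_invariant[of i n "\<lambda>z. 0 < z"])
  fix z :: nat assume "z < n" "0 < z"
  then show "0 < 2 * z mod n"
    using \<open>odd n\<close> by (auto simp: double_mod not_less le_less)
qed (use assms in auto)

text \<open>Negation commutes with doubling modulo \<open>n\<close>. Residues in the orbit are
  nonzero, so the negative of such a residue \<open>z\<close> is \<open>n - z\<close> without
  further reduction.\<close>

lemma orbit_complement:
  fixes i n t :: nat
  assumes "odd n" "0 < i" "i < n"
  shows "(n - i) * 2 ^ t mod n = n - i * 2 ^ t mod n"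
proof (induction t)
  case 0
  then show ?case using assms by simp
next
  case (Suc t)
  define z where "z = i * 2 ^ t mod n"
  have z: "0 < z" "z < n" using orbit_pos[OF assms, of t] assms by (auto simp: z_def)
  have "(n - i) * 2 ^ Suc t mod n = 2 * ((n - i) * 2 ^ t mod n) mod n"
    by (simp add: mod_mult_right_eq mult_ac)
  also have "\<dots> = 2 * (n - z) mod n" by (simp add: Suc z_def)
  also have "\<dots> = n - 2 * z mod n"
  proof -
    have "2 * z \<noteq> n" using \<open>odd n\<close> by auto
    then show ?thesis using z by (subst (1 2) double_mod) auto
  qed
  also have "2 * z mod n = i * 2 ^ Suc t mod n"
    by (simp add: z_def mod_mult_right_eq mult_ac)
  finally show ?case .
qed

text \<open>Used to move the leading binary digit of \<open>a\<close> to position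
  \<open>m - 1\<close>: the least shift reaching it does not overshoot.\<close>

lemma ex_scaled_in_top_half:
  fixes a m :: nat
  assumes "0 < a" "a < 2 ^ m"
  obtains j where "2 ^ m \<le> 2 * (a * 2 ^ j)" "a * 2 ^ j < 2 ^ m"
proof -
  define j where "j = (LEAST j. 2 ^ m \<le> 2 * (a * 2 ^ j))"
  have "2 ^ m \<le> 2 * (a * 2 ^ m)" using assms by simp
  then have j: "2 ^ m \<le> 2 * (a * 2 ^ j)" unfolding j_def by (rule LeastI)
  have "a * 2 ^ j < 2 ^ m"
  proof (cases j)
    case (Suc j')
    then have "j' < j" by simp
    then have "\<not> 2 ^ m \<le> 2 * (a * 2 ^ j')" unfolding j_def by (rule not_less_Least)
    then show ?thesis using Suc by simp
  qed (use assms in simp)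
  with j show ?thesis by (rule that)
qed

text \<open>Let a rotation with leading digit at \<open>m - 1\<close> be
  \<open>2 ^ (m - 1) + r\<close>, so \<open>r < 2 ^ k\<close>; the next rotation is
  \<open>2 * r + 1\<close>. If \<open>r > 0\<close>, this is an odd number of at most
  \<open>k + 1\<close> digits and not a power of two. Shifting its leading digit to
  \<open>m - 1\<close> takes its last digit to a position \<open>s \<ge> k\<close>, and the result
  is too large.\<close>

lemma orbit_below_imp_one:
  fixes i k m n :: nat
  assumes n: "n = 2 ^ m - 1" and k: "2 * k + 1 \<le> m" and i: "0 < i" "i < n"
    and small: "\<And>t. i * 2 ^ t mod n < 2 ^ (m - 1) + 2 ^ k"
  shows "\<exists>t. i * 2 ^ t mod n = 1"
proof (rule ccontr)
  assume no1: "\<nexists>t. i * 2 ^ t mod n = 1"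
  have m2: "2 ^ m = 2 * (2::nat) ^ (m - 1)" using k by (cases m) auto
  have shift: "\<exists>t'. i * 2 ^ t' mod n = (i * 2 ^ t mod n) * 2 ^ s mod n" for t s
    by (rule exI[of _ "t + s"]) (simp add: mod_mult_left_eq power_add flip: mult.assoc)
  have "i < 2 ^ m" using i n by simp
  then obtain j where j: "2 ^ m \<le> 2 * (i * 2 ^ j)" "i * 2 ^ j < 2 ^ m"
    using ex_scaled_in_top_half[of i m] i by blast
  have ij: "i * 2 ^ j < n"
  proof (rule ccontr)
    assume "\<not> i * 2 ^ j < n"
    then have "i * 2 ^ j mod n = 0" using j n by (simp add: le_mod_geq)
    moreover have "odd n" using n i by (cases m) auto
    ultimately show False using orbit_pos[of n i j] i by simp
  qed
  obtain r where r: "i * 2 ^ j = 2 ^ (m - 1) + r"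
    using j m2 by (metis le_Suc_ex mult_le_cancel1 zero_less_numeral)
  have rk: "r < 2 ^ k" using small[of j] ij r by simp
  obtain t1 where "i * 2 ^ t1 mod n = 2 * (i * 2 ^ j) mod n"
    using shift[of j 1] ij by (auto simp: mult.commute)
  moreover have "2 * (i * 2 ^ j) mod n = 2 * r + 1"
    using ij r n m2 i by (subst double_mod) auto
  ultimately have t1: "i * 2 ^ t1 mod n = 2 * r + 1" by simp
  with no1 have "0 < r" by (metis mult_0_right add_0 gr0I)
  have km: "(2::nat) * 2 ^ k \<le> 2 ^ (m - k)"
    using k power_increasing[of "k + 1" "m - k" "2::nat"] by simp
  have "i * 2 ^ t1 mod n < n" using i by simp
  then have "2 * r + 1 < 2 ^ m" using t1 n by linarith
  then obtain s where s: "2 ^ m \<le> 2 * ((2 * r + 1) * 2 ^ s)" "(2 * r + 1) * 2 ^ s < 2 ^ m"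
    using ex_scaled_in_top_half[of "2 * r + 1" m] by auto
  have "2 ^ m < 2 * ((2 * 2 ^ k) * (2::nat) ^ s)"
  proof -
    have "(2 * r + 1) * 2 ^ s < (2 * 2 ^ k) * (2::nat) ^ s"
      using rk by (intro mult_strict_right_mono) auto
    then show ?thesis using s(1) by linarith
  qed
  then have "(2::nat) ^ m < 2 ^ (k + s + 2)" by (simp add: power_add)
  then have "m < k + s + 2" by (rule power_less_imp_less_exp[rotated]) simp
  then have sk: "m \<le> k + s + 1" by simp
  have "s < m"
  proof (rule ccontr)
    assume "\<not> s < m"
    then have "(2::nat) ^ m \<le> 1 * 2 ^ s" by simp
    also have "\<dots> \<le> (2 * r + 1) * 2 ^ s" by (intro mult_le_mono1) simp
    finally show False using s(2) by simp
  qed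
  then have sm: "s \<le> m - 1" by simp
  \<comment> \<open>\<open>e\<close> is the position of the leading digit of
    \<open>2 * r + 1\<close>, which, being odd and above 1, exceeds \<open>2 ^ e\<close>.\<close>
  define e where "e = m - 1 - s"
  have e: "2 ^ (m - 1) = 2 ^ e * (2::nat) ^ s" using sm by (simp add: e_def flip: power_add)
  have "2 ^ e * 2 ^ s \<le> (2 * r + 1) * 2 ^ s" using s(1) unfolding m2 e by linarith
  then have "2 ^ e \<le> 2 * r + 1" by (rule mult_right_le_imp_le) simp
  moreover have "2 ^ e \<noteq> 2 * r + 1"
  proof (cases e)
    case (Suc e')
    then have "even ((2::nat) ^ e)" by simp
    moreover have "odd (2 * r + 1)" by simp
    ultimately show ?thesis by metis
  qed (use \<open>0 < r\<close> in simp)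
  ultimately have "2 ^ e + 1 \<le> 2 * r + 1" by simp
  then have "(2 ^ e + 1) * 2 ^ s \<le> (2 * r + 1) * 2 ^ s" by (rule mult_le_mono1)
  moreover have "(2::nat) ^ k \<le> 2 ^ s" using sk k by (intro power_increasing) auto
  moreover have "(2::nat) ^ (m - 1) + 2 ^ s = (2 ^ e + 1) * 2 ^ s" using e by simp
  ultimately have big: "2 ^ (m - 1) + 2 ^ k \<le> (2 * r + 1) * 2 ^ s" by linarith
  obtain t2 where t2: "i * 2 ^ t2 mod n = (2 * r + 1) * 2 ^ s mod n"
    using shift[of t1 s] t1 by auto
  have "odd n" using n i by (cases m) auto
  then have "(2 * r + 1) * 2 ^ s mod n \<noteq> 0" using orbit_pos[of n i t2] i t2 by simp
  then have "(2 * r + 1) * 2 ^ s \<noteq> n" by auto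
  then have "(2 * r + 1) * 2 ^ s < n" using s(2) n by simp
  then show False using t2 small[of t2] big by simp
qed

lemma orbit_of_one_le:
  fixes n m t :: nat
  assumes n: "n = 2 ^ m - 1" and "2 \<le> m"
  shows "2 ^ t mod n \<le> 2 ^ (m - 1)"
proof -
  have "\<exists>s<m. 1 * 2 ^ t mod n = 2 ^ s"
  proof (rule orbit_invariant[of 1 n "\<lambda>z. \<exists>s<m. z = 2 ^ s"])
    have "(2::nat) ^ 2 \<le> 2 ^ m" using \<open>2 \<le> m\<close> by (intro power_increasing) auto
    then show "1 < n" using n by simp
    show "\<exists>s<m. 1 = (2::nat) ^ s" using \<open>2 \<le> m\<close> by (intro exI[of _ 0]) auto
  next
    fix z :: nat
    assume "z < n" "\<exists>s<m. z = 2 ^ s"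
    then obtain s where s: "s < m" "z = 2 ^ s" by auto
    show "\<exists>s<m. 2 * z mod n = 2 ^ s"
    proof (cases "Suc s = m")
      case True
      then have "2 * z = n + 1" using s n by auto
      then have "2 * z mod n = 2 ^ 0" using double_mod[OF \<open>z < n\<close>] by simp
      then show ?thesis using s by (intro exI[of _ 0]) auto
    next
      case False
      then have sm: "Suc (Suc s) \<le> m" using s by simp
      have "(2::nat) ^ Suc (Suc s) \<le> 2 ^ m" using sm by (intro power_increasing) auto
      moreover have "1 < (2::nat) ^ Suc s" by (rule one_less_power) auto
      ultimately have "2 * z < n" using s n by simp
      then show ?thesis using False s by (intro exI[of _ "Suc s"]) auto
    qed
  qed
  then obtain s where "s < m" "2 ^ t mod n = 2 ^ s" by auto
  moreover from this have "(2::nat) ^ s \<le> 2 ^ (m - 1)" by (intro power_increasing) auto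
  ultimately show ?thesis by simp
qed


section \<open>Orbits that exclude the remaining designed distances\<close>

text \<open>By \<open>char\<close> an orbit goes below \<open>\<delta>'\<close> iff its complement
  never goes below \<open>\<delta>\<close>. The orbit of \<open>y\<close> is bounded by
  \<open>M\<close>, so its complement stays at \<open>\<delta>\<close> or above, and some rotation
  of \<open>y\<close> is below \<open>\<delta>'\<close>. Then so is \<open>x\<close>, although the
  complement of one of its rotations is below \<open>\<delta>\<close>.\<close>

lemma obstruction:
  fixes x y L M n \<delta> \<delta>' :: nat
  assumes "odd n" "0 < \<delta>" "\<delta> \<le> n" "0 < x" "x < n" "0 < y" "y < n" "x \<le> L"
    and y: "\<And>t. L \<le> y * 2 ^ t mod n \<and> y * 2 ^ t mod n \<le> M"
    and x: "n < x * 2 ^ s mod n + \<delta>"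
    and M: "M + \<delta> \<le> n"
    and char: "\<forall>i\<in>{1..<n}. (\<exists>t. (n - i) * 2 ^ t mod n < \<delta>) \<longleftrightarrow> \<not> (\<exists>t. i * 2 ^ t mod n < \<delta>')"
  shows False
proof -
  have "\<not> (n - y) * 2 ^ t mod n < \<delta>" for t
    using orbit_complement[of n y t] y[of t] M \<open>odd n\<close> \<open>0 < y\<close> \<open>y < n\<close> by linarith
  then obtain t where "y * 2 ^ t mod n < \<delta>'"
    using char assms by (metis One_nat_def Suc_leI atLeastLessThan_iff)
  then have "x * 2 ^ 0 mod n < \<delta>'" using y[of t] \<open>x \<le> L\<close> \<open>x < n\<close> by simp
  then have "\<not> (n - x) * 2 ^ s mod n < \<delta>" using char assms by (metis One_nat_def Suc_leI atLeastLessThan_iff)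
  then show False using orbit_complement[of n x s] x assms by simp
qed

text \<open>The least element exceeding \<open>2 ^ (m - 1)\<close> that is maximal in its orbit has two binary
  digits \<open>1\<close>, at cyclic distances \<open>k + 1\<close> and \<open>m - 1 - k\<close>.\<close>

lemma two_digit_orbit:
  fixes k m n t :: nat
  assumes n: "n = 2 ^ m - 1" and m: "m \<ge> 6" and k: "k = (m - 1) div 2"
  defines "y \<equiv> 1 + 2 ^ (k + 1)"
  shows "3 \<le> y * 2 ^ t mod n \<and> y * 2 ^ t mod n \<le> 2 ^ (m - 1) + 2 ^ k" and "y < n"
proof -
  have pow_less: "2 ^ a + 2 ^ b < (2::nat) ^ m - 1" if "a < b" "b < m - 1" for a b
  proof -
    have "(2::nat) * 2 ^ a \<le> 2 ^ b" using that power_increasing[of "Suc a" b "2::nat"] by simp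
    moreover have "(4::nat) * 2 ^ b \<le> 2 ^ m" using that power_increasing[of "b + 2" m "2::nat"] by simp
    moreover have "(1::nat) \<le> 2 ^ a" by simp
    ultimately show ?thesis by linarith
  qed
  \<comment> \<open>The two distances add up to \<open>m\<close>: when the upper digit wraps around
    to position 0, one turns into the other.\<close>
  define P where "P z \<longleftrightarrow> (\<exists>a b. a < b \<and> b < m \<and> z = 2 ^ a + 2 ^ b \<and> (b - a = k + 1 \<or> b - a = m - 1 - k))"
    for z :: nat
  have "k + 1 < m - 1" using k m by auto
  then show y: "y < n" unfolding y_def n using pow_less[of 0 "k + 1"] by simp
  have "P (y * 2 ^ t mod n)"
  proof (rule orbit_invariant[OF y])
    show "P y" unfolding P_def y_def
      using \<open>k + 1 < m - 1\<close> by (intro exI[of _ 0] exI[of _ "k + 1"]) auto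
  next
    fix z assume "z < n" "P z"
    then obtain a b where ab: "a < b" "b < m" "z = 2 ^ a + 2 ^ b" "b - a = k + 1 \<or> b - a = m - 1 - k"
      unfolding P_def by auto
    show "P (2 * z mod n)"
    proof (cases "Suc b = m")
      case True
      then have "2 * z = 2 ^ Suc a + (n + 1)" using ab(3) n by auto
      moreover have "2 * z mod n = (if 2 * z < n then 2 * z else 2 * z - n)"
        using \<open>z < n\<close> by (rule double_mod)
      ultimately have "2 * z mod n = 2 ^ 0 + 2 ^ Suc a" by simp
      moreover have "Suc a - 0 = k + 1 \<or> Suc a - 0 = m - 1 - k"
        using ab True by auto
      ultimately show ?thesis unfolding P_def using ab
        by (intro exI[of _ 0] exI[of _ "Suc a"]) auto
    next
      case False
      then have "2 * z mod n = 2 ^ Suc a + 2 ^ Suc b"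
      proof (cases "Suc b < m - 1")
        case True
        then show ?thesis using ab pow_less[of "Suc a" "Suc b"] n by simp
      next
        case False
        with \<open>Suc b \<noteq> m\<close> ab have b: "Suc b = m - 1" by simp
        have "Suc (Suc a) < m - 1" using b ab(4) k m by auto
        then have "(4::nat) * 2 ^ Suc a \<le> 2 ^ (m - 1)"
          using power_increasing[of "Suc a + 2" "m - 1" "2::nat"] by (simp add: not_less)
        moreover have "2 ^ m = 2 * (2::nat) ^ (m - 1)" using m by (cases m) auto
        moreover have "(1::nat) \<le> 2 ^ a" by simp
        ultimately have "2 ^ Suc a + 2 ^ Suc b < n" unfolding b n power_Suc[of _ a] by linarith
        then show ?thesis using ab by simp
      qed
      then show ?thesis unfolding P_def using ab False
        by (intro exI[of _ "Suc a"] exI[of _ "Suc b"]) auto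
    qed
  qed
  then obtain a b where ab: "a < b" "b < m" "y * 2 ^ t mod n = 2 ^ a + 2 ^ b"
      "b - a = k + 1 \<or> b - a = m - 1 - k"
    unfolding P_def by auto
  \<comment> \<open>Both distances are at least \<open>m - 1 - k\<close>, hence the lower digit is
    at position at most \<open>k\<close>.\<close>
  have "1 \<le> b" "a \<le> k" using ab k m by auto
  have "(2::nat) \<le> 2 ^ b" using power_increasing[OF \<open>1 \<le> b\<close>, of "2::nat"] by simp
  moreover have "(1::nat) \<le> 2 ^ a" by simp
  moreover have "(2::nat) ^ b \<le> 2 ^ (m - 1)" using ab by (intro power_increasing) auto
  moreover have "(2::nat) ^ a \<le> 2 ^ k" using \<open>a \<le> k\<close> by (intro power_increasing) auto
  ultimately show "3 \<le> y * 2 ^ t mod n \<and> y * 2 ^ t mod n \<le> 2 ^ (m - 1) + 2 ^ k"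
    unfolding ab(3) by linarith
qed


lemma two_power_mod_3: "2 ^ s mod 3 = (if even s then 1 else 2 :: nat)"
proof (induction s)
  case (Suc s)
  have "2 ^ Suc s mod 3 = 2 * (2 ^ s mod 3) mod (3::nat)" by (simp add: mod_mult_right_eq)
  then show ?case by (simp add: Suc)
qed simp

text \<open>The digits of \<open>y\<close> alternate as \<open>01...01\<close>; doubling modulo
  \<open>n\<close> exchanges \<open>n / 3\<close> and \<open>2 * n / 3\<close>, which keeps the
  orbit away from both ends of the range.\<close>

lemma third_orbit_even:
  fixes n m t :: nat
  assumes n: "n = 2 ^ m - 1" and m: "even m" "0 < m"
  defines "y \<equiv> n div 3"
  shows "n \<le> 3 * (y * 2 ^ t mod n) \<and> 3 * (y * 2 ^ t mod n) \<le> 2 * n" and "3 * y = n"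
proof -
  have "(2::nat) ^ m mod 3 = 1" using m by (simp add: two_power_mod_3)
  then have "3 dvd n" unfolding n by (metis dvd_minus_mod)
  then show y: "3 * y = n" by (simp add: y_def)
  have "2 ^ 1 \<le> (2::nat) ^ m" using m by (intro power_increasing) auto
  then have "0 < n" unfolding n by simp
  have "3 * (y * 2 ^ t mod n) = n \<or> 3 * (y * 2 ^ t mod n) = 2 * n"
  proof (rule orbit_invariant[of y n "\<lambda>z. 3 * z = n \<or> 3 * z = 2 * n"])
    show "y < n" using y \<open>0 < n\<close> by simp
    show "3 * y = n \<or> 3 * y = 2 * n" using y by simp
  next
    fix z assume "z < n" "3 * z = n \<or> 3 * z = 2 * n"
    then show "3 * (2 * z mod n) = n \<or> 3 * (2 * z mod n) = 2 * n"
      unfolding double_mod[OF \<open>z < n\<close>] using \<open>0 < n\<close> by auto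
  qed
  then show "n \<le> 3 * (y * 2 ^ t mod n) \<and> 3 * (y * 2 ^ t mod n) \<le> 2 * n" by auto
qed

text \<open>For odd \<open>m\<close> the role of \<open>n / 3\<close> is played by the orbits of \<open>0(01)...(01)\<close> and
  \<open>(01)...(01)1\<close>, whose elements differ from \<open>n / 3\<close> or \<open>2 n / 3\<close> by a third of a power of two.\<close>

lemma third_orbit_odd_lower:
  fixes n m t :: nat
  assumes n: "n = 2 ^ m - 1" and m: "odd m" "3 \<le> m"
  defines "y \<equiv> (2 ^ (m - 1) - 1) div 3"
  shows "2 ^ (m - 1) - 1 \<le> 3 * (y * 2 ^ t mod n) \<and> 3 * (y * 2 ^ t mod n) < 2 * n"
    and "0 < y" "y < n"
proof -
  have em: "even (m - 1)" using m by simp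
  then have "(2::nat) ^ (m - 1) mod 3 = 1" by (simp add: two_power_mod_3)
  then have "3 dvd (2::nat) ^ (m - 1) - 1" by (metis dvd_minus_mod)
  then have y: "3 * y = 2 ^ (m - 1) - 1" by (simp add: y_def)
  have "2 ^ 2 \<le> (2::nat) ^ (m - 1)" using m by (intro power_increasing) auto
  then have four: "4 \<le> (2::nat) ^ (m - 1)" by simp
  have m2: "2 ^ m = 2 * (2::nat) ^ (m - 1)" using m by (cases m) auto
  show "0 < y" using y four by auto
  show yn: "y < n" using y four m2 n by linarith
  \<comment> \<open>Doubling modulo \<open>n\<close> raises \<open>s\<close> and exchanges the
    multiples \<open>n\<close> and \<open>2 * n\<close>. At \<open>s = m - 1\<close> the term
    \<open>2 ^ m\<close> equals \<open>n + 1\<close>, which restarts the cycle at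
    \<open>s = 0\<close>; both exponents are even, so parity still selects the multiple.\<close>
  define P where "P z \<longleftrightarrow> (\<exists>s<m. 3 * z + 2 ^ s = (if even s then n else 2 * n))" for z
  have "P (y * 2 ^ t mod n)"
  proof (rule orbit_invariant[OF yn])
    have "3 * y + 2 ^ (m - 1) = n" using y four n m2 by linarith
    then show "P y" unfolding P_def using em m by (intro exI[of _ "m - 1"]) simp
  next
    fix z assume zn: "z < n" and "P z"
    then obtain s where s: "s < m" "3 * z + 2 ^ s = (if even s then n else 2 * n)"
      unfolding P_def by auto
    show "P (2 * z mod n)"
    proof (cases "Suc s = m")
      case True
      then have sm: "s = m - 1" by simp
      then have "3 * z + 2 ^ (m - 1) = n" using s em by simp
      then have "3 * (2 * z) + 1 = n" using n m2 four by linarith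
      moreover from this have "2 * z < n" by linarith
      ultimately have "3 * (2 * z mod n) + 2 ^ 0 = n" using double_mod[OF zn] by simp
      then show ?thesis unfolding P_def using m by (intro exI[of _ 0]) auto
    next
      case False
      have p: "(2::nat) ^ Suc s = 2 * 2 ^ s" "0 < (2::nat) ^ s" by simp_all
      have "3 * (2 * z mod n) + 2 ^ Suc s = (if even (Suc s) then n else 2 * n)"
      proof (cases "even s")
        case True
        then have e: "3 * z + 2 ^ s = n" using s by simp
        then have "2 * z < n" using p by linarith
        then have q: "2 * z mod n = 2 * z" by simp
        show ?thesis unfolding q using e True p by simp
      next
        case odd: False
        then have e: "3 * z + 2 ^ s = 2 * n" using s by simp
        have "(2::nat) ^ Suc s \<le> 2 ^ (m - 1)" using s False by (intro power_increasing) auto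
        then have "2 * z \<ge> n" using e p n m2 four by linarith
        then have "2 * z mod n = 2 * z - n" using double_mod[OF zn] by simp
        then show ?thesis using e odd p \<open>n \<le> 2 * z\<close> by simp
      qed
      then show ?thesis unfolding P_def using False s by (intro exI[of _ "Suc s"]) simp
    qed
  qed
  then obtain s where s: "s < m" "3 * (y * 2 ^ t mod n) + 2 ^ s = (if even s then n else 2 * n)"
    unfolding P_def by auto
  have "(2::nat) ^ s \<le> 2 ^ (m - 1)" "0 < (2::nat) ^ s" using s by (auto intro: power_increasing)
  then show "2 ^ (m - 1) - 1 \<le> 3 * (y * 2 ^ t mod n) \<and> 3 * (y * 2 ^ t mod n) < 2 * n"
    using s(2) n m2 four by (simp only: split: if_splits) linarith+
qed

lemma third_orbit_odd_upper:
  fixes n m t :: nat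
  assumes n: "n = 2 ^ m - 1" and m: "odd m" "3 \<le> m"
  defines "y \<equiv> (n + 2) div 3"
  shows "n < 3 * (y * 2 ^ t mod n) \<and> 3 * (y * 2 ^ t mod n) \<le> 2 * n + 2 ^ (m - 1)"
    and "0 < y" "y < n"
proof -
  have em: "even (m - 1)" using m by simp
  have "2 ^ 2 \<le> (2::nat) ^ (m - 1)" using m by (intro power_increasing) auto
  then have four: "4 \<le> (2::nat) ^ (m - 1)" by simp
  have m2: "2 ^ m = 2 * (2::nat) ^ (m - 1)" using m by (cases m) auto
  have "(2::nat) ^ m mod 3 = 2" using m by (simp add: two_power_mod_3)
  moreover have "n + 2 = 2 ^ m + 1" using n four m2 by simp
  ultimately have "3 dvd n + 2" by presburger
  then have y: "3 * y = n + 2" by (simp add: y_def)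
  show "0 < y" using y by auto
  show yn: "y < n" using y four m2 n by linarith
  \<comment> \<open>The same cycle with \<open>2 ^ s\<close> added to the multiple of
    \<open>n\<close>, entered at \<open>s = 1\<close> because \<open>3 * y = n + 2\<close>.\<close>
  define P where "P z \<longleftrightarrow> (\<exists>s<m. 3 * z = (if odd s then n else 2 * n) + 2 ^ s)" for z
  have "P (y * 2 ^ t mod n)"
  proof (rule orbit_invariant[OF yn])
    show "P y" unfolding P_def using m y by (intro exI[of _ 1]) simp
  next
    fix z assume zn: "z < n" and "P z"
    then obtain s where s: "s < m" "3 * z = (if odd s then n else 2 * n) + 2 ^ s"
      unfolding P_def by auto
    show "P (2 * z mod n)"
    proof (cases "Suc s = m")
      case True
      then have sm: "s = m - 1" by simp
      then have e: "3 * z = 2 * n + 2 ^ (m - 1)" using s em by simp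
      then have "n \<le> 2 * z" by linarith
      moreover have "3 * (2 * z) = 5 * n + 1" using e n m2 four by linarith
      ultimately have "3 * (2 * z mod n) = 2 * n + 2 ^ 0" using double_mod[OF zn] by simp
      then show ?thesis unfolding P_def using m by (intro exI[of _ 0]) auto
    next
      case False
      have p: "(2::nat) ^ Suc s = 2 * 2 ^ s" "0 < (2::nat) ^ s" by simp_all
      have "3 * (2 * z mod n) = (if odd (Suc s) then n else 2 * n) + 2 ^ Suc s"
      proof (cases "odd s")
        case True
        then have e: "3 * z = n + 2 ^ s" using s by simp
        have "(2::nat) ^ Suc s \<le> 2 ^ (m - 1)" using s False by (intro power_increasing) auto
        then have "2 * z < n" using e p n m2 four by linarith
        then have q: "2 * z mod n = 2 * z" by simp
        show ?thesis unfolding q using e True p by simp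
      next
        case even: False
        then have e: "3 * z = 2 * n + 2 ^ s" using s by simp
        then have "2 * z \<ge> n" by linarith
        then have "2 * z mod n = 2 * z - n" using double_mod[OF zn] by simp
        then show ?thesis using e even p \<open>n \<le> 2 * z\<close> by simp
      qed
      then show ?thesis unfolding P_def using False s by (intro exI[of _ "Suc s"]) simp
    qed
  qed
  then obtain s where s: "s < m" "3 * (y * 2 ^ t mod n) = (if odd s then n else 2 * n) + 2 ^ s"
    unfolding P_def by auto
  have "(2::nat) ^ s \<le> 2 ^ (m - 1)" "0 < (2::nat) ^ s" using s by (auto intro: power_increasing)
  then show "n < 3 * (y * 2 ^ t mod n) \<and> 3 * (y * 2 ^ t mod n) \<le> 2 * n + 2 ^ (m - 1)"
    using s(2) n m2 four by (simp only: split: if_splits) linarith+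
qed

text \<open>The complement of \<open>i\<close> has 1 in its orbit, so that orbit consists of powers
  of two up to \<open>2 ^ (m - 1)\<close>.\<close>

lemma orbit_of_top:
  fixes n m t :: nat
  assumes n: "n = 2 ^ m - 1" and m: "2 \<le> m" and i: "0 < i" "i < n"
    and top: "i * 2 ^ t mod n = n - 1"
  shows "2 ^ (m - 1) - 1 \<le> i * 2 ^ s mod n"
proof -
  have "odd n" using n i by (cases m) auto
  have m2: "2 ^ m = 2 * (2::nat) ^ (m - 1)" using m by (cases m) auto
  have one: "(n - i) * 2 ^ t mod n = 1" using orbit_complement[OF \<open>odd n\<close> i, of t] top i by simp
  \<comment> \<open>Here \<open>m * t\<close> is a multiple of the period that is at least
    \<open>t\<close>; it allows \<open>t\<close> doublings to be undone by further
    doublings.\<close>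
  have "2 ^ (m * t) mod n = 1"
  proof -
    have "(2 ^ m) mod n = 1"
    proof -
      have "2 ^ m = n + 1" using n by simp
      then show ?thesis using i by (simp add: mod_Suc)
    qed
    then have "(2 ^ m) ^ t mod n = 1 ^ t mod n" by (metis power_mod)
    then show ?thesis using i by (simp add: power_mult)
  qed
  then have "(n - i) * 2 ^ s mod n = (n - i) * 2 ^ s * 2 ^ (m * t) mod n"
    by (metis mod_mult_right_eq mult.right_neutral)
  also have "\<dots> = ((n - i) * 2 ^ t) * 2 ^ (m * t - t + s) mod n"
  proof -
    have "1 * t \<le> m * t" using m by (intro mult_le_mono1) simp
    then have "s + m * t = t + (m * t - t + s)" by linarith
    then have "2 ^ s * 2 ^ (m * t) = (2::nat) ^ t * 2 ^ (m * t - t + s)" by (simp only: flip: power_add)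
    then show ?thesis by (simp add: mult.assoc)
  qed
  also have "\<dots> = 2 ^ (m * t - t + s) mod n" using one by (metis mod_mult_left_eq mult_1)
  also have "\<dots> \<le> 2 ^ (m - 1)" by (rule orbit_of_one_le[OF n m])
  finally have "n - i * 2 ^ s mod n \<le> 2 ^ (m - 1)"
    using orbit_complement[OF \<open>odd n\<close> i, of s] by simp
  then show ?thesis using n m2 by linarith
qed

section \<open>Designed distances admitting a bound \<open>\<delta>'\<close>\<close>

text \<open>This is the theorem for exponents. The witness \<open>\<delta>'\<close> is
  \<open>2 ^ (m - 1) - 1\<close> if \<open>\<delta> \<le> 3\<close> and 2 in the interval; all other
  \<open>\<delta>\<close> are refuted by \<open>obstruction\<close> or, from
  \<open>2 ^ (m - 1)\<close> on, by the exponent 1.\<close>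

lemma complement_orbit_characterization:
  fixes m n \<delta> :: nat
  assumes m: "m \<ge> 6" and n: "n = 2 ^ m - 1" and \<delta>: "2 \<le> \<delta>" "\<delta> \<le> n"
  shows "(\<exists>\<delta>'. 2 \<le> \<delta>' \<and> \<delta>' \<le> n \<and> (\<forall>i\<in>{1..<n}.
      (\<exists>t. (n - i) * 2 ^ t mod n < \<delta>) \<longleftrightarrow> \<not> (\<exists>t. i * 2 ^ t mod n < \<delta>'))) \<longleftrightarrow>
    \<delta> = 2 \<or> \<delta> = 3 \<or>
    (2 ^ (m - 1) - 2 ^ ((m - 1) div 2) \<le> \<delta> \<and> \<delta> \<le> 2 ^ (m - 1) - 1)"
    (is "(\<exists>\<delta>'. 2 \<le> \<delta>' \<and> \<delta>' \<le> n \<and> ?char \<delta>') \<longleftrightarrow> ?R")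
proof
  define k where "k = (m - 1) div 2"
  define p :: nat where "p = 2 ^ (m - 3)"
  have m3: "m = Suc (Suc (Suc (m - 3)))" using m by simp
  have p4: "2 ^ (m - 1) = 4 * p" "2 ^ m = 8 * p"
    unfolding p_def by (subst m3, simp)+
  have "2 ^ 3 \<le> p" unfolding p_def using m by (intro power_increasing) auto
  then have p8: "8 \<le> p" by simp
  have n8: "n = 8 * p - 1" using n p4 by simp
  have oddn: "odd n" using n8 p8 by simp
  have "1 < n" using n8 p8 by simp
  have ck: "2 * k + 1 \<le> m" using m unfolding k_def by simp
  {
    assume "\<exists>\<delta>'. 2 \<le> \<delta>' \<and> \<delta>' \<le> n \<and> ?char \<delta>'"
    then obtain \<delta>' where \<delta>': "2 \<le> \<delta>'" "\<delta>' \<le> n" "?char \<delta>'" by auto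
    show ?R
    proof (rule ccontr)
      assume "\<not> ?R"
      then have nR: "4 \<le> \<delta>" "\<delta> + 2 ^ k < 4 * p \<or> 4 * p \<le> \<delta>"
        using \<delta> unfolding p4 k_def by auto
      note obs = obstruction[OF oddn _ \<delta>(2) _ _ _ _ _ _ _ _ \<delta>'(3)]
      consider "4 * p \<le> \<delta>" | "\<delta> + 2 ^ k < 4 * p" "2 * p \<le> \<delta>" | "\<delta> < 2 * p" using nR by linarith
      then show False
      proof cases
        case 1
        \<comment> \<open>The exponent 1 is on both sides: \<open>n - 1\<close> rotates to
          \<open>n - 2 ^ (m - 1)\<close>, which is below \<open>\<delta>\<close>, while 1 is below
          \<open>\<delta>'\<close>.\<close>
        have "(n - 1) * 2 ^ (m - 1) mod n = n - 1 * 2 ^ (m - 1) mod n"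
          using oddn n8 p8 by (intro orbit_complement) auto
        also have "\<dots> = 4 * p - 1" using p4 n8 p8 by simp
        also have "\<dots> < \<delta>" using 1 p8 by simp
        finally have "\<exists>t. (n - 1) * 2 ^ t mod n < \<delta>" by blast
        moreover have "1 * 2 ^ 0 mod n < \<delta>'" using \<delta>' n8 p8 by simp
        moreover have "1 \<in> {1..<n}" using n8 p8 by simp
        ultimately show False using \<delta>'(3) by blast
      next
        case 2
        note y = two_digit_orbit[OF n m k_def]
        \<comment> \<open>The rotation of 3 with digits \<open>11\<close> in front is
          \<open>6 * p\<close>, which exceeds \<open>n - \<delta>\<close> since
          \<open>2 * p \<le> \<delta>\<close>.\<close>
        show False
        proof (rule obs[where x = 3 and y = "1 + 2 ^ (k + 1)" and s = "m - 2" and L = 3])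
          show "3 \<le> (1 + 2 ^ (k + 1)) * 2 ^ t mod n \<and>
              (1 + 2 ^ (k + 1)) * 2 ^ t mod n \<le> 4 * p + 2 ^ k" for t
            using y(1)[of t] p4 by simp
          have "m - 2 = Suc (m - 3)" using m by simp
          then have "2 ^ (m - 2) = 2 * p" unfolding p_def by simp
          then show "n < 3 * 2 ^ (m - 2) mod n + \<delta>" using n8 p8 2 by simp
        qed (use y(2) \<delta> n8 p8 2 in auto)
      next
        case 3
        \<comment> \<open>Blocks of \<open>m - 2\<close> and \<open>m - 3\<close> ones: shifted to
          the front they become \<open>n - 3\<close> and \<open>n - 7\<close>, which exceed
          \<open>n - \<delta>\<close> for \<open>\<delta> \<ge> 4\<close> and
          \<open>\<delta> \<ge> 8\<close>.\<close>
        have x2: "n < (2 * p - 1) * 2 ^ 2 mod n + \<delta>" using n8 p8 nR by simp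
        have x3: "n < (p - 1) * 2 ^ 3 mod n + \<delta>" if "8 \<le> \<delta>" using n8 p8 that by simp
        show False
        proof (cases "even m")
          case True
          have "0 < m" using m by simp
          define y where "y = n div 3"
          have y: "n \<le> 3 * (y * 2 ^ t mod n)" "3 * (y * 2 ^ t mod n) \<le> 2 * n" "3 * y = n" for t
            using third_orbit_even[OF n True \<open>0 < m\<close>] unfolding y_def by auto
          show False
          proof (rule obs[where x = "2 * p - 1" and y = y and s = 2 and L = "2 * p - 1" and M = "n - \<delta>"])
            show "2 * p - 1 \<le> y * 2 ^ t mod n \<and> y * 2 ^ t mod n \<le> n - \<delta>" for t
              using y(1,2)[of t] n8 p8 3 by linarith
          qed (use y(3) \<delta> n8 p8 x2 in auto)
        next
          case False
          have "3 \<le> m" using m by simp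
          \<comment> \<open>The upper orbit stays above \<open>2 * p - 1\<close> but may reach about
            \<open>20 * p / 3\<close>, which suits small \<open>\<delta>\<close> only. The lower
            orbit stays below \<open>2 * n / 3\<close> but comes down to about
            \<open>4 * p / 3\<close>, so the shorter block \<open>p - 1\<close> is needed, which
            takes \<open>\<delta> \<ge> 8\<close>.\<close>
          show False
          proof (cases "\<delta> < 8")
            case True
            define y where "y = (n + 2) div 3"
            have y: "n < 3 * (y * 2 ^ t mod n)" "3 * (y * 2 ^ t mod n) \<le> 2 * n + 4 * p"
              "0 < y" "y < n" for t
              using third_orbit_odd_upper[OF n False \<open>3 \<le> m\<close>] unfolding y_def p4 by auto
            show False
            proof (rule obs[where x = "2 * p - 1" and y = y and s = 2 and L = "2 * p - 1" and M = "n - \<delta>"])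
              show "2 * p - 1 \<le> y * 2 ^ t mod n \<and> y * 2 ^ t mod n \<le> n - \<delta>" for t
                using y(1,2)[of t] n8 p8 True by linarith
            qed (use y(3,4) \<delta> n8 p8 x2 in auto)
          next
            case False8: False
            define y where "y = (2 ^ (m - 1) - 1 :: nat) div 3"
            have y: "4 * p - 1 \<le> 3 * (y * 2 ^ t mod n)" "3 * (y * 2 ^ t mod n) < 2 * n"
              "0 < y" "y < n" for t
              using third_orbit_odd_lower[OF n False \<open>3 \<le> m\<close>] unfolding y_def p4 by auto
            show False
            proof (rule obs[where x = "p - 1" and y = y and s = 3 and L = "p - 1" and M = "n - \<delta>"])
              show "p - 1 \<le> y * 2 ^ t mod n \<and> y * 2 ^ t mod n \<le> n - \<delta>" for t
                using y(1,2)[of t] n8 p8 3 by linarith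
            qed (use y(3,4) \<delta> n8 p8 x3 False8 in auto)
          qed
        qed
      qed
    qed
  next
    assume R: ?R
    show "\<exists>\<delta>'. 2 \<le> \<delta>' \<and> \<delta>' \<le> n \<and> ?char \<delta>'"
    proof (cases "\<delta> \<le> 3")
      case True
      \<comment> \<open>The orbit of \<open>n - 1\<close> has minimum \<open>4 * p - 1\<close>, with
        digits \<open>01...1\<close>, so it just fails to go below this
        \<open>\<delta>'\<close>.\<close>
      have "?char (4 * p - 1)"
      proof
        fix i assume "i \<in> {1..<n}"
        then have i: "0 < i" "i < n" by auto
        have comp: "(n - i) * 2 ^ t mod n = n - i * 2 ^ t mod n" for t
          by (rule orbit_complement[OF oddn i])
        show "(\<exists>t. (n - i) * 2 ^ t mod n < \<delta>) \<longleftrightarrow> \<not> (\<exists>t. i * 2 ^ t mod n < 4 * p - 1)"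
        proof
          assume "\<exists>t. (n - i) * 2 ^ t mod n < \<delta>"
          then obtain t where t: "(n - i) * 2 ^ t mod n < \<delta>" by auto
          have "\<exists>t. (n - i) * 2 ^ t mod n = 1"
          proof (cases "(n - i) * 2 ^ t mod n = 1")
            case False
            have "0 < (n - i) * 2 ^ t mod n" using i oddn by (intro orbit_pos) auto
            then have t2: "(n - i) * 2 ^ t mod n = 2" using t True False by linarith
            \<comment> \<open>Since \<open>\<delta> \<le> 3\<close>, the value 2 is the only
              alternative to 1, and \<open>m - 1\<close> more doublings take it to
              \<open>2 ^ m\<close>, that is, to 1.\<close>
            have "(n - i) * 2 ^ (t + (m - 1)) mod n = ((n - i) * 2 ^ t mod n) * 2 ^ (m - 1) mod n"
              by (simp add: power_add mod_mult_left_eq flip: mult.assoc)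
            also have "\<dots> = Suc n mod n" unfolding t2 p4 using n8 p8 by simp
            also have "\<dots> = 1" using \<open>1 < n\<close> by (simp add: mod_Suc)
            finally show ?thesis by blast
          qed blast
          then obtain t where "n - i * 2 ^ t mod n = 1" unfolding comp by blast
          then have "i * 2 ^ t mod n = n - 1" by linarith
          then have "2 ^ (m - 1) - 1 \<le> i * 2 ^ s mod n" for s
            using orbit_of_top[OF n _ i] m by simp
          then show "\<not> (\<exists>t. i * 2 ^ t mod n < 4 * p - 1)" using p4 by (auto simp: not_less)
        next
          assume "\<not> (\<exists>t. i * 2 ^ t mod n < 4 * p - 1)"
          then have big: "4 * p - 1 \<le> i * 2 ^ t mod n" for t by (meson not_less)
          have "\<exists>t. (n - i) * 2 ^ t mod n = 1"
          proof (rule orbit_below_imp_one[OF n ck])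
            show "(n - i) * 2 ^ t mod n < 2 ^ (m - 1) + 2 ^ k" for t
            proof -
              have "n - i * 2 ^ t mod n \<le> 4 * p" using big[of t] n8 p8 by linarith
              moreover have "(0::nat) < 2 ^ k" by simp
              ultimately show ?thesis unfolding comp p4 by linarith
            qed
          qed (use i in auto)
          then obtain t where "(n - i) * 2 ^ t mod n = 1" by blast
          then have "(n - i) * 2 ^ t mod n < \<delta>" using \<delta> by simp
          then show "\<exists>t. (n - i) * 2 ^ t mod n < \<delta>" by blast
        qed
      qed
      then show ?thesis using n8 p8 by (intro exI[of _ "4 * p - 1"]) auto
    next
      case False
      then have r: "4 * p \<le> \<delta> + 2 ^ k" "\<delta> < 4 * p" using R p8 unfolding p4 k_def by auto
      have "?char 2"
      proof
        fix i assume "i \<in> {1..<n}"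
        then have i: "0 < i" "i < n" by auto
        have comp: "(n - i) * 2 ^ t mod n = n - i * 2 ^ t mod n" for t
          by (rule orbit_complement[OF oddn i])
        show "(\<exists>t. (n - i) * 2 ^ t mod n < \<delta>) \<longleftrightarrow> \<not> (\<exists>t. i * 2 ^ t mod n < 2)"
        proof
          assume "\<exists>t. (n - i) * 2 ^ t mod n < \<delta>"
          then obtain t where t: "n - i * 2 ^ t mod n < \<delta>" unfolding comp by auto
          show "\<not> (\<exists>t. i * 2 ^ t mod n < 2)"
          proof
            assume "\<exists>t. i * 2 ^ t mod n < 2"
            then obtain s where "i * 2 ^ s mod n < 2" by auto
            then have "i * 2 ^ s mod n = 1" using orbit_pos[OF oddn i, of s] by simp
            then have "(n - i) * 2 ^ s mod n = n - 1" unfolding comp by simp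
            then have "2 ^ (m - 1) - 1 \<le> (n - i) * 2 ^ t mod n"
              using i m by (intro orbit_of_top[OF n]) auto
            then show False using t r p4 unfolding comp by simp
          qed
        next
          assume no: "\<not> (\<exists>t. i * 2 ^ t mod n < 2)"
          show "\<exists>t. (n - i) * 2 ^ t mod n < \<delta>"
          proof (rule ccontr)
            assume "\<not> ?thesis"
            then have le: "\<delta> \<le> n - i * 2 ^ t mod n" for t unfolding comp by (auto simp: not_less)
            have "i * 2 ^ t mod n < 2 ^ (m - 1) + 2 ^ k" for t
              using le[of t] \<delta> r n8 p8 unfolding p4 by linarith
            then have "\<exists>t. i * 2 ^ t mod n = 1" by (rule orbit_below_imp_one[OF n ck i])
            then obtain t where "i * 2 ^ t mod n = 1" by blast
            then have "i * 2 ^ t mod n < 2" by simp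
            with no show False by blast
          qed
        qed
      qed
      then show ?thesis using n8 p8 by (intro exI[of _ 2]) auto
    qed
  }
qed

subsection \<open>Evaluation of binary polynomials\<close>

text \<open>These rewrite rules turn the field operations of \<open>bit\<close> into Boolean ones, out of reach of
  the homomorphism laws below.\<close>

declare add_bit_eq_xor [simp del] mult_bit_eq_and [simp del]

locale binary_field_generator =
  fixes \<alpha> :: "'a::finite_field" and m n :: nat
  assumes card: "CARD('a) = 2 ^ m" and generator: "generates_units \<alpha>"
    and n: "n = 2 ^ m - 1" and m: "2 \<le> m"
begin

lemma n_gt_1: "1 < n"
proof -
  have "2 ^ 2 \<le> (2::nat) ^ m" using m by (intro power_increasing) auto
  then show ?thesis using n by simp
qed

lemma power_card: "x ^ (2 ^ m) = x" for x :: 'a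
  using finite_field_power_card_eq_same[of x] card by simp

text \<open>Raising to the even power \<open>2 ^ m\<close> sends -1 to 1, yet it fixes every field
  element.\<close>

lemma one_plus_one: "1 + 1 = (0 :: 'a)"
proof -
  have "(-1 :: 'a) ^ (2 ^ m) = 1" using m by simp
  then have "(-1 :: 'a) = 1" using power_card[of "-1"] by simp
  then show ?thesis by (metis add.right_inverse)
qed

lemma CHAR_eq_2: "CHAR('a) = 2"
proof -
  have "of_nat 2 = (0 :: 'a)" using one_plus_one by simp
  then have "CHAR('a) dvd 2" using of_nat_eq_0_iff_char_dvd by blast
  moreover have "CHAR('a) \<noteq> 1" using of_nat_CHAR[where 'a = 'a] by auto
  ultimately show ?thesis using prime_nat_iff two_is_prime_nat by blast
qed

lemma sum_power_2_power: "(\<Sum>i\<in>A. f i) ^ (2 ^ t) = (\<Sum>i\<in>A. f i ^ (2 ^ t))" for f :: "'b \<Rightarrow> 'a"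
  by (rule freshmans_dream_sum') (simp_all add: CHAR_eq_2)

definition embed_bit :: "bit \<Rightarrow> 'a" where
  "embed_bit b = of_bit b"

lemma embed_bit_0 [simp]: "embed_bit 0 = 0" and embed_bit_1 [simp]: "embed_bit 1 = 1"
  by (simp_all add: embed_bit_def)

lemma embed_bit_eq_0_iff [simp]: "embed_bit b = 0 \<longleftrightarrow> b = 0"
  by (cases b) auto

lemma embed_bit_add: "embed_bit (a + b) = embed_bit a + embed_bit b"
  using one_plus_one by (cases a; cases b) auto

lemma embed_bit_mult: "embed_bit (a * b) = embed_bit a * embed_bit b"
  by (cases a; cases b) auto

lemma embed_bit_sum: "embed_bit (\<Sum>i\<in>A. f i) = (\<Sum>i\<in>A. embed_bit (f i))"
  by (induction A rule: infinite_finite_induct) (simp_all add: embed_bit_add)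

lemma embed_bit_power_2_power: "embed_bit b ^ (2 ^ t) = embed_bit b"
  by (cases b) (auto simp: zero_power)

lemma eval_0 [simp]: "eval_bit_poly 0 (x :: 'a) = 0"
  by (simp add: eval_bit_poly_def)

lemma eval_pCons: "eval_bit_poly (pCons a p) (x :: 'a) = embed_bit a + x * eval_bit_poly p x"
  by (simp add: eval_bit_poly_def embed_bit_def map_poly_pCons)

lemma eval_1 [simp]: "eval_bit_poly 1 (x :: 'a) = 1"
  using eval_pCons[of 1 0 x] by (simp add: one_pCons)

lemma eval_monom [simp]: "eval_bit_poly (monom a i) (x :: 'a) = embed_bit a * x ^ i"
  by (simp add: eval_bit_poly_def embed_bit_def map_poly_monom poly_monom)

lemma eval_add [simp]:
  "eval_bit_poly (p + q) (x :: 'a) = eval_bit_poly p x + eval_bit_poly q x"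
proof (induction p q rule: poly_induct2)
  case (pCons a p b q)
  then show ?case by (simp add: eval_pCons embed_bit_add algebra_simps)
qed simp

lemma eval_sum: "eval_bit_poly (\<Sum>i\<in>A. f i) (x :: 'a) = (\<Sum>i\<in>A. eval_bit_poly (f i) x)"
  by (induction A rule: infinite_finite_induct) simp_all

lemma eval_smult [simp]: "eval_bit_poly (Polynomial.smult a p) (x :: 'a) = embed_bit a * eval_bit_poly p x"
  by (cases a) auto

lemma eval_mult [simp]:
  "eval_bit_poly (p * q) (x :: 'a) = eval_bit_poly p x * eval_bit_poly q x"
  by (induction p) (auto simp: eval_pCons algebra_simps)

lemma eval_diff [simp]:
  "eval_bit_poly (p - q) (x :: 'a) = eval_bit_poly p x - eval_bit_poly q x"
  using eval_add[of "p - q" q x] by (simp add: algebra_simps)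

text \<open>Frobenius fixes binary coefficients, so the zeros of a binary polynomial are closed
  under squaring.\<close>

lemma eval_power_2_power:
  "eval_bit_poly p (x ^ (2 ^ t)) = eval_bit_poly p (x :: 'a) ^ (2 ^ t)"
proof (induction p)
  case (pCons a p)
  have "(u + v) ^ (2 ^ t) = u ^ (2 ^ t) + v ^ (2 ^ t)" for u v :: 'a
    by (rule freshmans_dream') (simp_all add: CHAR_eq_2)
  then show ?case using pCons by (simp add: eval_pCons power_mult_distrib embed_bit_power_2_power)
qed (simp add: zero_power)

lemma eval_at_1: "eval_bit_poly p (1 :: 'a) = embed_bit (poly p 1)"
  by (induction p) (simp_all add: eval_pCons embed_bit_add)

lemma eval_code_poly:
  "c \<in> carrier_vec n \<Longrightarrow> eval_bit_poly (code_poly c) (x :: 'a) = (\<Sum>l<n. embed_bit (c $ l) * x ^ l)"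
  by (simp add: code_poly_def eval_sum carrier_vecD)

subsection \<open>Minimal polynomials\<close>

text \<open>Division with remainder settles the claim for every monic annihilator of least degree.
  As \<open>min_poly\<close> is a definite description, existence and uniqueness of such a
  polynomial are needed as well.\<close>

lemma min_poly_dvd_iff: "min_poly x dvd q \<longleftrightarrow> eval_bit_poly q (x :: 'a) = 0"
proof -
  define P where "P p \<longleftrightarrow> lead_coeff p = 1 \<and> eval_bit_poly p x = 0 \<and>
     (\<forall>q. q \<noteq> 0 \<and> eval_bit_poly q x = 0 \<longrightarrow> degree p \<le> degree q)" for p :: "bit poly"
  define s :: "bit poly" where "s = monom 1 (2 ^ m) - monom 1 1"
  have neq: "Suc 0 \<noteq> 2 ^ m" using n_gt_1 n by linarith
  have "coeff s (2 ^ m) = 1" unfolding s_def by (simp add: neq)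
  then have "s \<noteq> 0" by auto
  moreover have "eval_bit_poly s x = 0" by (simp add: s_def power_card)
  ultimately obtain p where p: "p \<noteq> 0 \<and> eval_bit_poly p x = 0"
      "\<forall>q. q \<noteq> 0 \<and> eval_bit_poly q x = 0 \<longrightarrow> degree p \<le> degree q"
    using ex_has_least_nat[of "\<lambda>p. p \<noteq> 0 \<and> eval_bit_poly p x = 0" s degree] by blast
  have "lead_coeff p = 1" using p(1) bit_not_zero_iff leading_coeff_0_iff by blast
  with p have "P p" unfolding P_def by blast
  have dvd: "p dvd q \<longleftrightarrow> eval_bit_poly q x = 0" if "P p" for p q
  proof
    assume "p dvd q"
    then show "eval_bit_poly q x = 0" using that by (auto simp: P_def)
  next
    assume q: "eval_bit_poly q x = 0"
    have "p \<noteq> 0" using that by (auto simp: P_def)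
    have "eval_bit_poly (q div p * p + q mod p) x = 0" using q by simp
    then have "eval_bit_poly (q mod p) x = 0"
      using that unfolding eval_add eval_mult P_def by simp
    then have "q mod p = 0"
      using that degree_mod_less[OF \<open>p \<noteq> 0\<close>, of q] unfolding P_def by (meson not_less)
    then show "p dvd q" by auto
  qed
  have "P (min_poly x)"
    unfolding min_poly_def P_def[symmetric]
  proof (rule theI)
    fix p' assume "P p'"
    have "p dvd p'" using dvd \<open>P p\<close> \<open>P p'\<close> by (auto simp: P_def)
    then obtain r where r: "p' = p * r" by blast
    have nz: "p \<noteq> 0" "p' \<noteq> 0" using \<open>P p\<close> \<open>P p'\<close> by (auto simp: P_def)
    then have "degree p' = degree p + degree r" using r by (auto simp: degree_mult_eq)
    moreover have "degree p' \<le> degree p" using \<open>P p\<close> \<open>P p'\<close> nz by (auto simp: P_def)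
    ultimately have "degree r = 0" by simp
    then obtain c where c: "r = [:c:]" by (rule degree_eq_zeroE)
    have "c = 1" using nz r c by (cases c) auto
    then show "p' = p" using r c by simp
  qed fact
  then show ?thesis by (rule dvd)
qed

lemma bch_gen_dvd_iff:
  "bch_gen \<alpha> \<delta> dvd q \<longleftrightarrow> (\<forall>j\<in>{1..\<delta> - 1}. eval_bit_poly q (\<alpha> ^ j) = 0)"
  unfolding bch_gen_def Lcm_dvd_iff by (simp add: min_poly_dvd_iff)

subsection \<open>Powers of the generator\<close>

lemma generator_nonzero: "\<alpha> \<noteq> 0"
proof -
  have "\<alpha> ^ 1 \<in> UNIV - {0}" using generator unfolding generates_units_def by blast
  then show ?thesis by simp
qed

lemma power_n: "x ^ n = 1" if "x \<noteq> 0" for x :: 'a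
proof -
  have "x * x ^ n = x ^ (2 ^ m)" by (simp add: n flip: power_Suc)
  then show ?thesis using power_card[of x] that by simp
qed

lemma generator_power_mod: "\<alpha> ^ (i mod n) = \<alpha> ^ i"
proof -
  have "\<alpha> ^ i = (\<alpha> ^ n) ^ (i div n) * \<alpha> ^ (i mod n)" by (simp flip: power_mult power_add)
  then show ?thesis by (simp add: power_n generator_nonzero)
qed

lemma bij_betw_generator_power: "bij_betw (\<lambda>i. \<alpha> ^ i) {..<n} (UNIV - {0})"
proof -
  have "\<alpha> ^ i \<in> (\<lambda>i. \<alpha> ^ i) ` {..<n}" for i
    using n_gt_1 generator_power_mod[of i] by (intro image_eqI[of _ _ "i mod n"]) auto
  then have "range (\<lambda>i. \<alpha> ^ i) \<subseteq> (\<lambda>i. \<alpha> ^ i) ` {..<n}" by (rule image_subsetI)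
  then have "(\<lambda>i. \<alpha> ^ i) ` {..<n} = range (\<lambda>i. \<alpha> ^ i)" by (intro equalityI) auto
  then have "(\<lambda>i. \<alpha> ^ i) ` {..<n} = UNIV - {0}"
    using generator unfolding generates_units_def by simp
  moreover have "card (UNIV - {0 :: 'a}) = n" using card n by (simp add: card_Diff_singleton)
  ultimately show ?thesis by (simp add: bij_betw_def eq_card_imp_inj_on)
qed

lemma generator_power_inject: "i < n \<Longrightarrow> j < n \<Longrightarrow> \<alpha> ^ i = \<alpha> ^ j \<longleftrightarrow> i = j"
  using bij_betw_generator_power unfolding bij_betw_def by (auto dest: inj_onD)

text \<open>For \<open>x \<noteq> 1\<close> the numerator \<open>x ^ n - 1\<close> is zero; for
  \<open>x = 1\<close> the sum is \<open>n\<close>, which is odd, hence 1 in characteristic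
  2.\<close>

lemma geometric_sum_unit: "(\<Sum>i<n. x ^ i) = of_bool (x = 1)" if "x \<noteq> 0" for x :: 'a
proof (cases "x = 1")
  case True
  have "of_nat (Suc n) = (of_nat (2 ^ m) :: 'a)" by (simp only: n) simp
  also have "\<dots> = 0" using m one_plus_one by (simp add: zero_power)
  finally have "of_nat n + 1 = (1 + 1 :: 'a)" using one_plus_one by (simp add: add.commute)
  then have "of_nat n = (1 :: 'a)" by (rule add_right_imp_eq)
  with True show ?thesis by simp
qed (simp add: geometric_sum power_n that)

subsection \<open>Cyclic codes described by their zeros\<close>

definition vanishing_code :: "'a set \<Rightarrow> bit vec set" where
  "vanishing_code T = {c \<in> carrier_vec n. \<forall>x\<in>T. eval_bit_poly (code_poly c) x = 0}"

text \<open>Reduction modulo \<open>x ^ n - 1\<close> preserves values at nonzero points, so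
  multiples of \<open>g\<close> stay zero on \<open>T\<close>; conversely a code polynomial has
  degree below \<open>n\<close> and is its own remainder.\<close>

lemma cyclic_code_eq_vanishing_code:
  assumes g: "\<And>q. g dvd q \<longleftrightarrow> (\<forall>x\<in>T. eval_bit_poly q x = 0)" and T: "0 \<notin> T"
  shows "cyclic_code n g = vanishing_code T"
proof -
  define h :: "bit poly" where "h = monom 1 n - 1"
  have cn: "coeff h n = 1" using n_gt_1 by (simp add: h_def)
  have dn: "degree h = n"
  proof (rule antisym)
    show "degree h \<le> n" unfolding h_def by (intro degree_diff_le) (auto simp: degree_monom_le)
    show "n \<le> degree h" using cn by (intro le_degree) simp
  qed
  have "(\<exists>u. code_poly c = u * g mod h) \<longleftrightarrow> g dvd code_poly c" if c: "c \<in> carrier_vec n" for c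
  proof
    assume "\<exists>u. code_poly c = u * g mod h"
    then obtain u where u: "code_poly c = u * g mod h" by blast
    show "g dvd code_poly c"
      unfolding g
    proof
      fix x assume "x \<in> T"
      then have "x \<noteq> 0" using T by auto
      then have "eval_bit_poly h x = 0" by (simp add: h_def power_n)
      moreover have "eval_bit_poly g x = 0" using g[of g] \<open>x \<in> T\<close> by simp
      moreover have "eval_bit_poly (u * g div h * h + code_poly c) x = eval_bit_poly (u * g) x"
        unfolding u by (simp only: div_mult_mod_eq)
      ultimately show "eval_bit_poly (code_poly c) x = 0" by simp
    qed
  next
    assume "g dvd code_poly c"
    moreover have "degree (code_poly c) \<le> n - 1"
      unfolding code_poly_def using c
      by (intro degree_sum_le) (auto intro: order.trans[OF degree_monom_le])
    then have "code_poly c mod h = code_poly c"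
      using dn n_gt_1 by (intro mod_poly_less) simp
    ultimately show "\<exists>u. code_poly c = u * g mod h" by (metis dvd_def mult.commute)
  qed
  then show ?thesis
    unfolding cyclic_code_def vanishing_code_def h_def[symmetric] g[symmetric] by blast
qed

text \<open>The union of the conjugacy classes of the \<open>\<alpha> ^ j\<close>. Frobenius is
  applied to \<open>x\<close> and not to \<open>\<alpha> ^ j\<close>, which gives the same set
  because it has finite order.\<close>

definition bch_zeros :: "nat \<Rightarrow> 'a set" where
  "bch_zeros \<delta> = {x. \<exists>t. \<exists>j\<in>{1..\<delta> - 1}. x ^ (2 ^ t) = \<alpha> ^ j}"

lemma zero_notin_bch_zeros: "0 \<notin> bch_zeros \<delta>"
  using generator_nonzero by (auto simp: bch_zeros_def zero_power dest!: sym[of 0])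

lemma bch_zeros_square: "x \<in> bch_zeros \<delta> \<Longrightarrow> x\<^sup>2 \<in> bch_zeros \<delta>"
proof -
  assume "x \<in> bch_zeros \<delta>"
  then obtain t j where tj: "j \<in> {1..\<delta> - 1}" "x ^ (2 ^ t) = \<alpha> ^ j" by (auto simp: bch_zeros_def)
  \<comment> \<open>Together with the squaring these are \<open>m + t\<close> Frobenius steps,
    \<open>m\<close> of which act trivially.\<close>
  have "(x\<^sup>2) ^ (2 ^ (m - 1 + t)) = (x ^ (2 ^ m)) ^ (2 ^ t)"
  proof -
    have "2 * 2 ^ (m - 1 + t) = 2 ^ m * (2::nat) ^ t" using m by (simp flip: power_Suc power_add)
    then show ?thesis by (simp only: flip: power_mult)
  qed
  then have "(x\<^sup>2) ^ (2 ^ (m - 1 + t)) = \<alpha> ^ j" using tj power_card[of x] by simp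
  then show ?thesis using tj(1) unfolding bch_zeros_def by blast
qed

lemma eval_zero_on_bch_zeros:
  "(\<forall>x\<in>bch_zeros \<delta>. eval_bit_poly q x = 0) \<longleftrightarrow> (\<forall>j\<in>{1..\<delta> - 1}. eval_bit_poly q (\<alpha> ^ j) = 0)"
proof
  assume *: "\<forall>j\<in>{1..\<delta> - 1}. eval_bit_poly q (\<alpha> ^ j) = 0"
  show "\<forall>x\<in>bch_zeros \<delta>. eval_bit_poly q x = 0"
  proof
    fix x assume "x \<in> bch_zeros \<delta>"
    then obtain t j where tj: "j \<in> {1..\<delta> - 1}" "x ^ (2 ^ t) = \<alpha> ^ j" by (auto simp: bch_zeros_def)
    have "eval_bit_poly q x ^ (2 ^ t) = 0" using eval_power_2_power[of q x t] tj * by simp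
    then show "eval_bit_poly q x = 0" by simp
  qed
next
  assume *: "\<forall>x\<in>bch_zeros \<delta>. eval_bit_poly q x = 0"
  have "\<alpha> ^ j \<in> bch_zeros \<delta>" if "j \<in> {1..\<delta> - 1}" for j
    unfolding bch_zeros_def using that by (auto intro!: exI[of _ "0::nat"])
  with * show "\<forall>j\<in>{1..\<delta> - 1}. eval_bit_poly q (\<alpha> ^ j) = 0" by blast
qed

lemma bch_code_eq: "bch_code \<alpha> n \<delta> = vanishing_code (bch_zeros \<delta>)"
  unfolding bch_code_def
  by (rule cyclic_code_eq_vanishing_code)
    (simp_all add: bch_gen_dvd_iff eval_zero_on_bch_zeros zero_notin_bch_zeros)

text \<open>As 1 is not a zero of \<open>bch_gen \<alpha> \<delta>\<close>, the factor
  \<open>x - 1\<close> is coprime to it, and divisibility by the product splits.\<close>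

lemma bch_code_tilde_eq:
  assumes "\<delta> \<le> n"
  shows "bch_code_tilde \<alpha> n \<delta> = vanishing_code (insert 1 (bch_zeros \<delta>))"
  unfolding bch_code_tilde_def
proof (rule cyclic_code_eq_vanishing_code)
  define g where "g = bch_gen \<alpha> \<delta>"
  \<comment> \<open>The sum of all \<open>x ^ i\<close> vanishes at every unit except 1, so
    \<open>g\<close> divides it, and its value 1 at 1 gives
    \<open>poly g 1 \<noteq> 0\<close>.\<close>
  define s :: "bit poly" where "s = (\<Sum>i<n. monom 1 i)"
  have s: "eval_bit_poly s x = of_bool (x = 1)" if "x \<noteq> 0" for x :: 'a
    using geometric_sum_unit[OF that] by (simp add: s_def eval_sum)
  have "\<alpha> ^ j \<noteq> 1" if "j \<in> {1..\<delta> - 1}" for j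
  proof -
    have "j < n" "j \<noteq> 0" using that assms n_gt_1 by auto
    then show ?thesis using generator_power_inject[of j 0] n_gt_1 by simp
  qed
  then have "g dvd s" unfolding g_def bch_gen_dvd_iff using s generator_nonzero by simp
  moreover have "poly s 1 \<noteq> 0"
  proof
    assume "poly s 1 = 0"
    then show False using s[of 1] by (simp add: eval_at_1)
  qed
  ultimately have g1: "poly g 1 \<noteq> 0" by (metis dvdE poly_mult mult_zero_left)
  have x1: "monom 1 1 - 1 = [:- 1, 1 :: bit:]"
    by (simp add: monom_altdef one_pCons)
  have root: "eval_bit_poly q 1 = (0 :: 'a) \<longleftrightarrow> [:- 1, 1:] dvd q" for q
    unfolding eval_at_1 poly_eq_0_iff_dvd[symmetric] by simp
  show "(monom 1 1 - 1) * bch_gen \<alpha> \<delta> dvd q \<longleftrightarrow> (\<forall>x\<in>insert 1 (bch_zeros \<delta>). eval_bit_poly q x = 0)" for q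
  proof -
    have "[:- 1, 1:] * g dvd q \<longleftrightarrow> [:- 1, 1:] dvd q \<and> g dvd q"
    proof safe
      assume "[:- 1, 1:] dvd q" "g dvd q"
      then obtain r where r: "q = g * r" by blast
      have "poly q 1 = 0" using \<open>[:- 1, 1:] dvd q\<close> by (simp add: poly_eq_0_iff_dvd)
      then have "poly r 1 = 0" using g1 r by simp
      then have "[:- 1, 1:] dvd r" by (simp add: poly_eq_0_iff_dvd)
      then show "[:- 1, 1:] * g dvd q" unfolding r by (metis mult.commute mult_dvd_mono dvd_refl)
    qed (blast dest: dvd_mult_left dvd_mult_right)+
    then show ?thesis
      unfolding x1 g_def[symmetric]
      by (simp add: root eval_zero_on_bch_zeros g_def bch_gen_dvd_iff)
  qed
qed (simp add: zero_notin_bch_zeros)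

subsection \<open>Trace code words\<close>

definition trace :: "'a \<Rightarrow> 'a" where
  "trace x = (\<Sum>t<m. x ^ (2 ^ t))"

text \<open>Squaring shifts the terms of the trace cyclically, so the trace is fixed by
  squaring.\<close>

lemma trace_cases: "trace x = 0 \<or> trace x = 1"
proof -
  have "(x ^ (2 ^ t)) ^ (2 ^ 1) = x ^ (2 ^ Suc t)" for t
    by (simp add: mult.commute flip: power_mult)
  then have "trace x ^ (2 ^ 1) = (\<Sum>t<m. x ^ (2 ^ Suc t))"
    unfolding trace_def sum_power_2_power by (simp only:)
  then have "trace x ^ 2 = (\<Sum>t<m. x ^ (2 ^ Suc t))" by simp
  also have "\<dots> + x ^ (2 ^ 0) = trace x + x ^ (2 ^ m)"
    unfolding trace_def using sum.lessThan_Suc_shift[of "\<lambda>t. x ^ (2 ^ t)" m]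
    unfolding sum.lessThan_Suc by (simp only: add.commute o_def)
  finally have "trace x ^ 2 = trace x" by (simp add: power_card)
  then show ?thesis by (simp add: power2_eq_square)
qed

text \<open>As a polynomial in \<open>\<theta>\<close> the sum is nonzero of degree at most
  \<open>2 ^ (m - 1)\<close>, too small to vanish on all \<open>2 ^ m\<close> elements.\<close>

lemma exists_linearized_sum_nonzero:
  assumes "S \<subseteq> {..<m}" "S \<noteq> {}"
  shows "\<exists>\<theta> :: 'a. (\<Sum>t\<in>S. \<theta> ^ (2 ^ t)) \<noteq> 0"
proof -
  define P :: "'a poly" where "P = (\<Sum>t\<in>S. monom 1 (2 ^ t))"
  have fin: "finite S" using assms finite_subset by blast
  obtain t0 where t0: "t0 \<in> S" using assms by blast
  have "coeff P (2 ^ t0) = (\<Sum>t\<in>S. of_bool (t = t0))" by (simp add: P_def coeff_sum of_bool_def)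
  also have "\<dots> = 1" using t0 fin by simp
  finally have "P \<noteq> 0" by auto
  have "degree P \<le> 2 ^ (m - 1)"
    unfolding P_def using assms fin
    by (intro degree_sum_le) (auto intro!: order.trans[OF degree_monom_le] power_increasing)
  also have "\<dots> < (2::nat) ^ m" using m by simp
  also have "\<dots> = card (UNIV :: 'a set)" using card by simp
  finally have "card {x. poly P x = 0} < card (UNIV :: 'a set)"
    using card_poly_roots_bound[OF \<open>P \<noteq> 0\<close>] by linarith
  then obtain \<theta> where "poly P \<theta> \<noteq> 0" by (metis (mono_tags) UNIV_eq_I less_irrefl mem_Collect_eq)
  then show ?thesis by (intro exI[of _ \<theta>]) (simp add: P_def poly_sum poly_monom)
qed

definition trace_word :: "'a \<Rightarrow> 'a \<Rightarrow> bit vec" where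
  "trace_word \<theta> x = vec n (\<lambda>l. of_bool (trace (\<theta> * x ^ l) = 1))"

lemma trace_word_carrier [simp]: "trace_word \<theta> x \<in> carrier_vec n"
  by (simp add: trace_word_def)

lemma embed_bit_trace_word: "l < n \<Longrightarrow> embed_bit (trace_word \<theta> x $ l) = trace (\<theta> * x ^ l)"
  using trace_cases[of "\<theta> * x ^ l"] by (auto simp: trace_word_def)

text \<open>One expansion for two purposes: powers of \<open>y\<close> as \<open>f\<close> give the
  value at \<open>y\<close>, the entries of a word as \<open>f\<close> give an inner
  product.\<close>

lemma sum_trace_word:
  "(\<Sum>l<n. embed_bit (trace_word \<theta> x $ l) * f l) = (\<Sum>t<m. \<theta> ^ (2 ^ t) * (\<Sum>l<n. f l * (x ^ (2 ^ t)) ^ l))"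
proof -
  have "(\<Sum>l<n. embed_bit (trace_word \<theta> x $ l) * f l) = (\<Sum>l<n. \<Sum>t<m. \<theta> ^ (2 ^ t) * (f l * (x ^ (2 ^ t)) ^ l))"
    by (intro sum.cong refl)
      (simp add: embed_bit_trace_word trace_def sum_distrib_left power_mult_distrib mult_ac flip: power_mult)
  then show ?thesis by (subst (asm) sum.swap) (simp add: sum_distrib_left)
qed

lemma eval_trace_word:
  assumes "x \<noteq> 0" "y \<noteq> 0"
  shows "eval_bit_poly (code_poly (trace_word \<theta> x)) y = (\<Sum>t | t < m \<and> y * x ^ (2 ^ t) = 1. \<theta> ^ (2 ^ t))"
proof -
  have "eval_bit_poly (code_poly (trace_word \<theta> x)) y =
      (\<Sum>t<m. \<theta> ^ (2 ^ t) * (\<Sum>l<n. (y * x ^ (2 ^ t)) ^ l))"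
    unfolding eval_code_poly[OF trace_word_carrier] sum_trace_word power_mult_distrib ..
  also have "\<dots> = (\<Sum>t<m. \<theta> ^ (2 ^ t) * of_bool (y * x ^ (2 ^ t) = 1))"
    using assms by (simp add: geometric_sum_unit)
  also have "\<dots> = (\<Sum>t | t < m \<and> y * x ^ (2 ^ t) = 1. \<theta> ^ (2 ^ t))"
    by (auto simp: of_bool_def if_distrib sum.If_cases Int_def cong: if_cong intro!: sum.cong)
  finally show ?thesis .
qed

lemma closed_power:
  assumes closed: "\<And>x. x \<in> T \<Longrightarrow> x\<^sup>2 \<in> T" and "x \<in> T"
  shows "x ^ (2 ^ t) \<in> (T :: 'a set)"
proof (induction t)
  case (Suc t)
  have "x ^ (2 ^ Suc t) = (x ^ (2 ^ t))\<^sup>2" by (simp add: mult.commute flip: power_mult)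
  then show ?case using closed[OF Suc] by simp
qed (use \<open>x \<in> T\<close> in simp)

lemma closed_power_iff:
  assumes closed: "\<And>x. x \<in> T \<Longrightarrow> x\<^sup>2 \<in> T" and "t < m"
  shows "x ^ (2 ^ t) \<in> (T :: 'a set) \<longleftrightarrow> x \<in> T"
proof
  assume "x ^ (2 ^ t) \<in> T"
  from closed_power[OF closed this, of "m - t"]
  have "x ^ (2 ^ t * 2 ^ (m - t)) \<in> T" by (simp add: power_mult)
  also have "2 ^ t * 2 ^ (m - t) = (2::nat) ^ m" using \<open>t < m\<close> by (simp flip: power_add)
  finally show "x \<in> T" by (simp add: power_card)
qed (rule closed_power[OF closed])

text \<open>A nonempty sum in \<open>eval_trace_word\<close> would make \<open>y\<close> a conjugate
  of \<open>inverse x\<close>, which closure of \<open>T\<close> under squaring forbids.\<close>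

lemma trace_word_vanishes:
  assumes closed: "\<And>x. x \<in> T \<Longrightarrow> x\<^sup>2 \<in> T" and "0 \<notin> T" "x \<noteq> 0" "inverse x \<notin> T"
  shows "trace_word \<theta> x \<in> vanishing_code T"
proof -
  have "eval_bit_poly (code_poly (trace_word \<theta> x)) y = 0" if "y \<in> T" for y
  proof -
    have "y * x ^ (2 ^ t) \<noteq> 1" if "t < m" for t
    proof
      assume "y * x ^ (2 ^ t) = 1"
      then have "inverse (x ^ (2 ^ t)) = y" by (intro inverse_unique) (simp add: mult.commute)
      then have "y = inverse x ^ (2 ^ t)" by (simp add: power_inverse)
      then show False using \<open>y \<in> T\<close> closed_power_iff[OF closed that, of "inverse x"] assms by simp
    qed
    moreover have "y \<noteq> 0" using that assms by auto
    ultimately show ?thesis using \<open>x \<noteq> 0\<close> by (simp add: eval_trace_word cong: conj_cong)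
  qed
  then show ?thesis by (simp add: vanishing_code_def)
qed

text \<open>An element \<open>x\<close> of \<open>T'\<close> outside \<open>T\<close> is separated
  by a trace word for \<open>inverse x\<close>: it vanishes on \<open>T\<close>, and for suitable
  \<open>\<theta>\<close> not at \<open>x\<close>, since the term with \<open>t = 0\<close> occurs
  there.\<close>

lemma vanishing_code_subset_imp:
  assumes closed: "\<And>x. x \<in> T \<Longrightarrow> x\<^sup>2 \<in> T" and T: "0 \<notin> T" "0 \<notin> T'"
    and sub: "vanishing_code T \<subseteq> vanishing_code T'"
  shows "T' \<subseteq> T"
proof (rule ccontr)
  assume "\<not> T' \<subseteq> T"
  then obtain x where x: "x \<in> T'" "x \<notin> T" by blast
  then have "x \<noteq> 0" using T by auto
  define S where "S = {t. t < m \<and> x * inverse x ^ (2 ^ t) = 1}"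
  have "0 \<in> S" using \<open>x \<noteq> 0\<close> m by (simp add: S_def)
  moreover have "S \<subseteq> {..<m}" by (auto simp: S_def)
  ultimately obtain \<theta> :: 'a where \<theta>: "(\<Sum>t\<in>S. \<theta> ^ (2 ^ t)) \<noteq> 0"
    using exists_linearized_sum_nonzero[of S] by blast
  have "trace_word \<theta> (inverse x) \<in> vanishing_code T"
    by (rule trace_word_vanishes[OF closed]) (use x \<open>x \<noteq> 0\<close> T in auto)
  with sub have "trace_word \<theta> (inverse x) \<in> vanishing_code T'" by blast
  then have "eval_bit_poly (code_poly (trace_word \<theta> (inverse x))) x = 0"
    using x by (simp add: vanishing_code_def)
  then show False using \<theta> \<open>x \<noteq> 0\<close> by (simp add: eval_trace_word S_def)
qed

lemma vanishing_code_eq_iff: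
  assumes "\<And>x. x \<in> T \<Longrightarrow> x\<^sup>2 \<in> T" "\<And>x. x \<in> T' \<Longrightarrow> x\<^sup>2 \<in> T'" "0 \<notin> T" "0 \<notin> T'"
  shows "vanishing_code T = vanishing_code T' \<longleftrightarrow> T = T'"
proof
  assume eq: "vanishing_code T = vanishing_code T'"
  show "T = T'"
    using vanishing_code_subset_imp[of T T'] vanishing_code_subset_imp[of T' T] assms eq by blast
qed simp

section \<open>Orthogonality and the zeros of the dual code\<close>

lemma sum_units_power_mult_inverse_power:
  assumes "l < n" "r < n"
  shows "(\<Sum>x\<in>UNIV - {0 :: 'a}. x ^ l * inverse x ^ r) = of_bool (l = r)"
proof -
  have "(\<Sum>x\<in>UNIV - {0 :: 'a}. x ^ l * inverse x ^ r) =
      (\<Sum>i<n. (\<alpha> ^ i) ^ l * inverse (\<alpha> ^ i) ^ r)"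
    by (rule sum.reindex_bij_betw[OF bij_betw_generator_power, symmetric])
  also have "\<dots> = (\<Sum>i<n. (\<alpha> ^ l * inverse (\<alpha> ^ r)) ^ i)"
    by (simp add: power_mult_distrib power_inverse mult.commute flip: power_mult)
  also have "\<dots> = of_bool (\<alpha> ^ l * inverse (\<alpha> ^ r) = 1)"
    using generator_nonzero by (intro geometric_sum_unit) simp
  also have "\<alpha> ^ l * inverse (\<alpha> ^ r) = 1 \<longleftrightarrow> \<alpha> ^ l = \<alpha> ^ r"
    using generator_nonzero by (simp add: field_simps)
  finally show ?thesis using generator_power_inject assms by simp
qed

text \<open>Expanding both values and applying orthogonality of the powers leaves the diagonal
  terms. The usual factor \<open>n\<close> is 1 in characteristic 2.\<close>

lemma parseval:
  assumes "v \<in> carrier_vec n" "c \<in> carrier_vec n"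
  shows "(\<Sum>x\<in>UNIV - {0 :: 'a}. eval_bit_poly (code_poly v) x * eval_bit_poly (code_poly c) (inverse x)) =
    embed_bit (v \<bullet> c)"
proof -
  have "(\<Sum>x\<in>UNIV - {0 :: 'a}. eval_bit_poly (code_poly v) x * eval_bit_poly (code_poly c) (inverse x)) =
      (\<Sum>x\<in>UNIV - {0 :: 'a}. \<Sum>l<n. \<Sum>r<n. embed_bit (v $ l) * embed_bit (c $ r) * (x ^ l * inverse x ^ r))"
    by (simp only: eval_code_poly assms sum_product mult_ac)
  also have "\<dots> = (\<Sum>l<n. \<Sum>r<n. \<Sum>x\<in>UNIV - {0 :: 'a}. embed_bit (v $ l) * embed_bit (c $ r) * (x ^ l * inverse x ^ r))"
    by (subst sum.swap, intro sum.cong refl sum.swap)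
  also have "\<dots> = (\<Sum>l<n. \<Sum>r<n. embed_bit (v $ l) * embed_bit (c $ r) * of_bool (l = r))"
    by (intro sum.cong refl) (simp only: sum_units_power_mult_inverse_power lessThan_iff flip: sum_distrib_left)
  also have "\<dots> = (\<Sum>l<n. embed_bit (v $ l) * embed_bit (c $ l))"
    by (intro sum.cong refl) (simp add: of_bool_def if_distrib cong: if_cong)
  also have "\<dots> = embed_bit (v \<bullet> c)"
    using assms(2) by (simp only: scalar_prod_def embed_bit_sum embed_bit_mult carrier_vecD atLeast0LessThan)
  finally show ?thesis .
qed

lemma dual_vanishing_code:
  assumes closed: "\<And>x. x \<in> T \<Longrightarrow> x\<^sup>2 \<in> T" and T: "0 \<notin> T"
  shows "dual_code n (vanishing_code T) = vanishing_code {x. x \<noteq> 0 \<and> inverse x \<notin> T}"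
proof (intro equalityI subsetI)
  fix v assume v: "v \<in> dual_code n (vanishing_code T)"
  then have vn: "v \<in> carrier_vec n" by (simp add: dual_code_def)
  have "eval_bit_poly (code_poly v) x = 0" if x: "x \<noteq> 0" "inverse x \<notin> T" for x
  proof (rule ccontr)
    define V where "V = eval_bit_poly (code_poly v) x"
    assume "eval_bit_poly (code_poly v) x \<noteq> 0"
    then have V0: "V \<noteq> 0" by (simp add: V_def)
    have "{..<m} \<noteq> {}" using m by (auto simp: lessThan_empty_iff)
    then obtain \<theta> where \<theta>: "trace \<theta> \<noteq> 0"
      using exists_linearized_sum_nonzero[of "{..<m}"] unfolding trace_def by blast
    \<comment> \<open>Scaling by \<open>V\<close> makes the inner product with \<open>v\<close>
      equal to the trace of \<open>\<theta>\<close>, because the values of \<open>v\<close> at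
      conjugates of \<open>x\<close> are conjugates of \<open>V\<close>.\<close>
    let ?c = "trace_word (\<theta> / V) x"
    have "?c \<in> vanishing_code T" by (rule trace_word_vanishes[OF closed T x])
    then have "v \<bullet> ?c = 0" using v by (simp add: dual_code_def)
    then have "?c \<bullet> v = 0" using vn by (metis comm_scalar_prod trace_word_carrier)
    then have "0 = embed_bit (?c \<bullet> v)" by simp
    also have "\<dots> = (\<Sum>l<n. embed_bit (?c $ l) * embed_bit (v $ l))"
      using vn by (simp only: scalar_prod_def embed_bit_sum embed_bit_mult carrier_vecD atLeast0LessThan)
    also have "\<dots> = (\<Sum>t<m. (\<theta> / V) ^ (2 ^ t) * eval_bit_poly (code_poly v) (x ^ (2 ^ t)))"
      unfolding sum_trace_word eval_code_poly[OF vn] ..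
    also have "\<dots> = trace \<theta>"
      using V0 unfolding trace_def by (simp add: eval_power_2_power power_divide flip: V_def)
    finally show False using \<theta> by simp
  qed
  then show "v \<in> vanishing_code {x. x \<noteq> 0 \<and> inverse x \<notin> T}" using vn by (simp add: vanishing_code_def)
next
  fix v assume "v \<in> vanishing_code {x. x \<noteq> 0 \<and> inverse x \<notin> T}"
  then have v: "v \<in> carrier_vec n"
      "\<And>x. x \<noteq> 0 \<Longrightarrow> inverse x \<notin> T \<Longrightarrow> eval_bit_poly (code_poly v) x = 0"
    by (auto simp: vanishing_code_def)
  have "v \<bullet> c = 0" if "c \<in> vanishing_code T" for c
  proof -
    have c: "c \<in> carrier_vec n" "\<And>x. x \<in> T \<Longrightarrow> eval_bit_poly (code_poly c) x = 0"
      using that by (auto simp: vanishing_code_def)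
    have "embed_bit (v \<bullet> c) = 0"
      unfolding parseval[OF v(1) c(1), symmetric]
    proof (rule sum.neutral, rule ballI)
      fix x :: 'a assume "x \<in> UNIV - {0}"
      then show "eval_bit_poly (code_poly v) x * eval_bit_poly (code_poly c) (inverse x) = 0"
        using v(2)[of x] c(2)[of "inverse x"] by (cases "inverse x \<in> T") auto
    qed
    then show ?thesis by simp
  qed
  then show "v \<in> dual_code n (vanishing_code T)" using v(1) by (simp add: dual_code_def)
qed

section \<open>Translation from zeros to exponents\<close>

lemma generator_power_in_bch_zeros_iff:
  assumes "\<delta> \<le> n" "0 < i" "i < n"
  shows "\<alpha> ^ i \<in> bch_zeros \<delta> \<longleftrightarrow> (\<exists>t. i * 2 ^ t mod n < \<delta>)"
proof -
  have "(\<exists>j\<in>{1..\<delta> - 1}. (\<alpha> ^ i) ^ (2 ^ t) = \<alpha> ^ j) \<longleftrightarrow> i * 2 ^ t mod n < \<delta>" for t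
  proof -
    have pos: "0 < i * 2 ^ t mod n" using assms n by (intro orbit_pos) (cases m, auto)
    have "(\<alpha> ^ i) ^ (2 ^ t) = \<alpha> ^ (i * 2 ^ t mod n)" by (simp add: generator_power_mod power_mult)
    moreover have "i * 2 ^ t mod n < n" using assms by simp
    ultimately have eq: "(\<alpha> ^ i) ^ (2 ^ t) = \<alpha> ^ j \<longleftrightarrow> i * 2 ^ t mod n = j" if "j \<in> {1..\<delta> - 1}" for j
      using that assms generator_power_inject[of "i * 2 ^ t mod n" j] by auto
    show ?thesis using pos by (auto simp: eq)
  qed
  then show ?thesis unfolding bch_zeros_def by simp
qed

text \<open>Codes are compared through their zeros, and the inverse of \<open>\<alpha> ^ i\<close>
  is \<open>\<alpha> ^ (n - i)\<close>. The exponent 0 drops out: the factor \<open>x - 1\<close>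
  removes 1 from the zeros of the dual, and no narrow-sense code with
  \<open>\<delta>' \<le> n\<close> has the zero 1.\<close>

lemma is_narrow_sense_bch_dual_iff:
  assumes \<delta>: "2 \<le> \<delta>" "\<delta> \<le> n"
  shows "is_narrow_sense_bch \<alpha> n (dual_code n (bch_code_tilde \<alpha> n \<delta>)) \<longleftrightarrow>
    (\<exists>\<delta>'. 2 \<le> \<delta>' \<and> \<delta>' \<le> n \<and> (\<forall>i\<in>{1..<n}.
      (\<exists>t. (n - i) * 2 ^ t mod n < \<delta>) \<longleftrightarrow> \<not> (\<exists>t. i * 2 ^ t mod n < \<delta>')))"
proof -
  let ?T = "insert 1 (bch_zeros \<delta>)"
  define D where "D = {x. x \<noteq> 0 \<and> inverse x \<notin> ?T}"
  have sq: "x\<^sup>2 \<in> ?T" if "x \<in> ?T" for x using that bch_zeros_square by auto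
  have dual: "dual_code n (bch_code_tilde \<alpha> n \<delta>) = vanishing_code D"
    unfolding bch_code_tilde_eq[OF \<delta>(2)] D_def
    by (rule dual_vanishing_code[OF sq]) (simp_all add: zero_notin_bch_zeros)
  have sqD: "x\<^sup>2 \<in> D" if "x \<in> D" for x
    using that closed_power_iff[OF sq, of 1 "inverse x"] m by (simp add: D_def power_inverse)
  have "dual_code n (bch_code_tilde \<alpha> n \<delta>) = bch_code \<alpha> n \<delta>' \<longleftrightarrow>
      (\<forall>i\<in>{1..<n}. (\<exists>t. (n - i) * 2 ^ t mod n < \<delta>) \<longleftrightarrow> \<not> (\<exists>t. i * 2 ^ t mod n < \<delta>'))"
    if \<delta>': "2 \<le> \<delta>'" "\<delta>' \<le> n" for \<delta>'
  proof -
    have one: "1 \<notin> bch_zeros \<delta>'"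
      using \<delta>' generator_power_inject[of 0] n_gt_1 by (fastforce simp: bch_zeros_def)
    have "dual_code n (bch_code_tilde \<alpha> n \<delta>) = bch_code \<alpha> n \<delta>' \<longleftrightarrow> D = bch_zeros \<delta>'"
      unfolding dual bch_code_eq
      by (rule vanishing_code_eq_iff) (use sqD bch_zeros_square zero_notin_bch_zeros in \<open>auto simp: D_def\<close>)
    also have "\<dots> \<longleftrightarrow> (\<forall>x\<in>UNIV - {0}. x \<in> D \<longleftrightarrow> x \<in> bch_zeros \<delta>')"
      using zero_notin_bch_zeros[of \<delta>'] by (auto simp: D_def)
    also have "UNIV - {0} = (\<lambda>i. \<alpha> ^ i) ` {..<n}"
      using bij_betw_generator_power by (simp add: bij_betw_def)
    also have "(\<forall>x\<in>(\<lambda>i. \<alpha> ^ i) ` {..<n}. x \<in> D \<longleftrightarrow> x \<in> bch_zeros \<delta>') \<longleftrightarrow>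
        (\<forall>i\<in>{..<n}. \<alpha> ^ i \<in> D \<longleftrightarrow> \<alpha> ^ i \<in> bch_zeros \<delta>')"
      by simp
    also have "{..<n} = insert 0 {1..<n}" using n_gt_1 by auto
    also have "(\<forall>i\<in>insert 0 {1..<n}. \<alpha> ^ i \<in> D \<longleftrightarrow> \<alpha> ^ i \<in> bch_zeros \<delta>') \<longleftrightarrow>
        (\<forall>i\<in>{1..<n}. \<alpha> ^ i \<in> D \<longleftrightarrow> \<alpha> ^ i \<in> bch_zeros \<delta>')"
      using one by (simp add: D_def)
    also have "\<dots> \<longleftrightarrow>
      (\<forall>i\<in>{1..<n}. (\<exists>t. (n - i) * 2 ^ t mod n < \<delta>) \<longleftrightarrow> \<not> (\<exists>t. i * 2 ^ t mod n < \<delta>'))"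
    proof (rule ball_cong[OF refl])
      fix i assume "i \<in> {1..<n}"
      then have i: "0 < i" "i < n" "0 < n - i" "n - i < n" by auto
      have "\<alpha> ^ i * \<alpha> ^ (n - i) = 1"
        using i power_n[OF generator_nonzero] by (simp flip: power_add)
      then have inv: "inverse (\<alpha> ^ i) = \<alpha> ^ (n - i)" by (rule inverse_unique)
      have "\<alpha> ^ i \<noteq> 1" "\<alpha> ^ (n - i) \<noteq> 1"
        using i generator_power_inject[of i 0] generator_power_inject[of "n - i" 0] by simp_all
      then have "\<alpha> ^ i \<in> D \<longleftrightarrow> \<alpha> ^ (n - i) \<notin> bch_zeros \<delta>"
        using generator_nonzero by (simp add: D_def inv)
      then show "(\<alpha> ^ i \<in> D \<longleftrightarrow> \<alpha> ^ i \<in> bch_zeros \<delta>') \<longleftrightarrow>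
          ((\<exists>t. (n - i) * 2 ^ t mod n < \<delta>) \<longleftrightarrow> \<not> (\<exists>t. i * 2 ^ t mod n < \<delta>'))"
        using generator_power_in_bch_zeros_iff[OF \<delta>(2) i(3,4)]
          generator_power_in_bch_zeros_iff[OF \<delta>'(2) i(1,2)] by blast
    qed
    finally show ?thesis .
  qed
  then show ?thesis unfolding is_narrow_sense_bch_def by blast
qed

end

theorem theorem14:
  fixes \<alpha> :: "'a::finite_field" and m n \<delta> :: nat
  assumes "m \<ge> 6"
    and "CARD('a) = 2 ^ m"
    and "generates_units \<alpha>"
    and "n = 2 ^ m - 1"
    and "2 \<le> \<delta>" and "\<delta> \<le> n"
  shows "is_narrow_sense_bch \<alpha> n (dual_code n (bch_code_tilde \<alpha> n \<delta>)) \<longleftrightarrow>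
    \<delta> = 2 \<or> \<delta> = 3 \<or>
    (2 ^ (m - 1) - 2 ^ ((m - 1) div 2) \<le> \<delta> \<and> \<delta> \<le> 2 ^ (m - 1) - 1)"
proof -
  interpret binary_field_generator \<alpha> m n
    by unfold_locales (use assms in auto)
  show ?thesis
    using is_narrow_sense_bch_dual_iff complement_orbit_characterization assms by simp
qed

end
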